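(* Let $\Phi=[\varphi_1,\cdots,\varphi_m]$ be an $n\times m$ matrix-valued function with columns $\varphi_j\in L^2_{\mathbb C^n}$, and let $r:=\mathrm{ind}_{\mathcal N}\{\varphi_1,\cdots,\varphi_m\}$. If $r<m$, then $\ker H_\Phi=\Theta H^2_{\mathbb C^{m-r}}$ for some $m\times(m-r)$ matrix inner function $\Theta\in H^\infty_{M_{m\times(m-r)}}$; if $r=m$, then $\ker H_\Phi=(0)$.
   Context: $\mathbb T$ is the unit circle with normalized Lebesgue measure. $L^p_{\mathbb C^n}$, $H^p_{\mathbb C^n}$ denote column vectors of $n$ functions in $L^p$, resp. $H^p$ (Hardy space), and $L^p_{M_{n\times m}}$, $H^p_{M_{n\times m}}$ the $n\times m$ matrix functions with entries in $L^p$, resp. $H^p$. The Nevanlinna class $\mathcal N$ is the set of functions on $\mathbb T$ of the form $f/g$ with $f,g\in H^\infty$, $g\neq 0$ (functions of bounded type); $\mathcal N_{\mathbb C^n}$ denotes column vectors with entries in $\mathcal N$. Vectors $\varphi_1,\dots,\varphi_r\in L^2_{\mathbb C^n}$ are called independent modulo Nevanlinna class if whenever $a_1,\dots,a_r\in\mathcal N$ and $a_1\varphi_1+\cdots+a_r\varphi_r\in\mathcal N_{\mathbb C^n}$, then $a_1=\cdots=a_r=0$. For a set $A\subset L^2_{\mathbb C^n}$ (columns counted as a list), $\mathrm{ind}_{\mathcal N}A$ is the supremum of the cardinalities of finite subsets of $A$ that are independent modulo Nevanlinna class ($0$ if there is none). For $\Phi\in L^2_{M_{n\times m}}$ the block Hankel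 operator is $H_\Phi f=J(I-P)(\Phi f)$, where $P$ is the Cauchy (Riesz) projection onto analytic functions and $J g(z)=\bar z g(\bar z)$; its kernel is $\ker H_\Phi=\{f\in H^2_{\mathbb C^m}:\Phi f\in H^1_{\mathbb C^n}\}$. A matrix function $\Theta\in H^\infty_{M_{m\times k}}$ is inner if $\Theta(\zeta)^*\Theta(\zeta)=I$ for a.e. $\zeta\in\mathbb T$. *)

theory Defs
  imports "HOL-Analysis.Analysis"
begin

text \<open>The unit circle T is parametrised by t in [0,1] via circ t = e^(2 pi i t);
  the normalised Lebesgue measure on T is the image of Lebesgue measure on [0,1].
  A scalar function on T is a function complex => complex (only its values on T matter).
  Vectors / matrices of functions are indexed by natural numbers with explicit bounds.\<close>

definition circ :: "real \<Rightarrow> complex" where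
  "circ t = cis (2 * pi * t)"

abbreviation Tmeas :: "real measure" where
  "Tmeas \<equiv> lebesgue_on {0..1}"

definition AE_T :: "(complex \<Rightarrow> bool) \<Rightarrow> bool" where
  "AE_T P \<longleftrightarrow> (AE t in Tmeas. P (circ t))"

definition meas_T :: "(complex \<Rightarrow> complex) \<Rightarrow> bool" where
  "meas_T f \<longleftrightarrow> (\<lambda>t. f (circ t)) \<in> borel_measurable Tmeas"

definition Lp :: "real \<Rightarrow> (complex \<Rightarrow> complex) \<Rightarrow> bool" where
  "Lp p f \<longleftrightarrow> meas_T f \<and> integrable Tmeas (\<lambda>t. norm (f (circ t)) powr p)"

definition Linf :: "(complex \<Rightarrow> complex) \<Rightarrow> bool" where
  "Linf f \<longleftrightarrow> meas_T f \<and> (\<exists>C. AE_T (\<lambda>z. norm (f z) \<le> C))"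

definition fourier_coeff :: "(complex \<Rightarrow> complex) \<Rightarrow> int \<Rightarrow> complex" where
  "fourier_coeff f k = integral\<^sup>L Tmeas (\<lambda>t. f (circ t) * cis (- 2 * pi * of_int k * t))"

definition Hp :: "real \<Rightarrow> (complex \<Rightarrow> complex) \<Rightarrow> bool" where
  "Hp p f \<longleftrightarrow> Lp p f \<and> (\<forall>k::int. k < 0 \<longrightarrow> fourier_coeff f k = 0)"

definition Hinf :: "(complex \<Rightarrow> complex) \<Rightarrow> bool" where
  "Hinf f \<longleftrightarrow> Linf f \<and> (\<forall>k::int. k < 0 \<longrightarrow> fourier_coeff f k = 0)"

definition Nev :: "(complex \<Rightarrow> complex) \<Rightarrow> bool" where
  "Nev f \<longleftrightarrow> (\<exists>g h. Hinf g \<and> Hinf h \<and> \<not> AE_T (\<lambda>z. h z = 0) \<and> AE_T (\<lambda>z. f z = g z / h z))"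

text \<open>Columns of Phi (n x m, entries Phi i j) indexed by a set S of column indices are
  independent modulo the Nevanlinna class (columns counted as a list, i.e. by index).\<close>
definition indep_Nev :: "nat \<Rightarrow> (nat \<Rightarrow> nat \<Rightarrow> complex \<Rightarrow> complex) \<Rightarrow> nat set \<Rightarrow> bool" where
  "indep_Nev n \<Phi> S \<longleftrightarrow>
     (\<forall>a :: nat \<Rightarrow> complex \<Rightarrow> complex.
        (\<forall>j\<in>S. Nev (a j)) \<and> (\<forall>i<n. Nev (\<lambda>z. \<Sum>j\<in>S. a j z * \<Phi> i j z))
        \<longrightarrow> (\<forall>j\<in>S. AE_T (\<lambda>z. a j z = 0)))"

definition ind_Nev :: "nat \<Rightarrow> nat \<Rightarrow> (nat \<Rightarrow> nat \<Rightarrow> complex \<Rightarrow> complex) \<Rightarrow> nat" where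
  "ind_Nev n m \<Phi> = Sup {card S | S. S \<subseteq> {..<m} \<and> indep_Nev n \<Phi> S}"

definition kerHankel :: "nat \<Rightarrow> nat \<Rightarrow> (nat \<Rightarrow> nat \<Rightarrow> complex \<Rightarrow> complex) \<Rightarrow> (nat \<Rightarrow> complex \<Rightarrow> complex) set" where
  "kerHankel n m \<Phi> = {f. (\<forall>j<m. Hp 2 (f j)) \<and> (\<forall>i<n. Hp 1 (\<lambda>z. \<Sum>j<m. \<Phi> i j z * f j z))}"

definition inner_matrix :: "nat \<Rightarrow> nat \<Rightarrow> (nat \<Rightarrow> nat \<Rightarrow> complex \<Rightarrow> complex) \<Rightarrow> bool" where
  "inner_matrix m k \<Theta> \<longleftrightarrow> (\<forall>i<m. \<forall>l<k. Hinf (\<Theta> i l)) \<and>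
     AE_T (\<lambda>z. \<forall>p<k. \<forall>q<k. (\<Sum>i<m. cnj (\<Theta> i p z) * \<Theta> i q z) = (if p = q then 1 else 0))"

end

theory Submission
  imports Defs
begin

text \<open>The kernel is a closed shift-invariant subspace of \<open>H\<^sup>2\<close>, so by Beurling--Lax--Halmos it equals \<open>\<Theta> H\<^sup>2\<close>
  for an inner \<open>m \<times> k\<close> matrix \<open>\<Theta>\<close>. Clearing denominators, the relations \<open>a\<close> over the Nevanlinna class with
  \<open>\<Phi> a\<close> in the Nevanlinna class are exactly the combinations of the columns of \<open>\<Theta>\<close>. If \<open>T\<close> is a set of \<open>k\<close>
  rows on which \<open>\<Theta>\<close> is injective, no nonzero relation is supported on the complement of \<open>T\<close>, while every index
  set with more than \<open>m - k\<close> elements supports one; hence the index is \<open>m - k\<close>.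

  The function theory is reduced to one fact: every nonzero closed shift-invariant subspace contains a vector of
  constant norm 1 on the circle that is orthogonal to all proper shifts of the subspace. Applied to
  \<open>{h. h = 0 on E}\<close> it shows that nonzero \<open>H\<^sup>2\<close> functions are nonzero almost everywhere, and applied to the graph
  of multiplication by \<open>f\<close> that \<open>H\<^sup>2\<close> is contained in the Nevanlinna class.\<close>

section \<open>Square-integrable functions\<close>

text \<open>Hardy functions occur only as boundary functions with vanishing negative Fourier
  coefficients; extension to the disc and inner-outer factorisation never enter. Their role is
  played by norm minimisation in L^2: a minimal-norm solution of linear conditions is orthogonal to
  every solution of the homogeneous conditions. With Fourier coefficients as conditions this yields
  orthogonality of functions with disjoint spectra, in place of Parseval; with the conditions
  defining an invariant subspace it yields the wandering vector. The norm of that vector is constant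
  because the coefficients of its square at nonzero indices vanish, so uniqueness of Fourier
  coefficients is the second pillar. Since \<Phi> is merely square integrable, \<Phi> f is only
  integrable. The kernel is therefore described by the coefficients of \<Phi> f, each a continuous
  functional of f because the rows of \<Phi> lie in L^2. Bounded relations a bring \<Phi> a back
  into L^2, so that quotient representations of H^2 functions suffice to compute the index.\<close>

definition L2 :: "'a measure \<Rightarrow> ('a \<Rightarrow> complex) \<Rightarrow> bool" where
  "L2 M f \<longleftrightarrow> f \<in> borel_measurable M \<and> integrable M (\<lambda>x. (norm (f x))\<^sup>2)"

lemma L2_measurable [measurable_dest]: "L2 M f \<Longrightarrow> f \<in> borel_measurable M"
  by (simp add: L2_def)

lemma L2_bound:
  assumes f: "f \<in> borel_measurable M" and g: "integrable M g"
    and le: "AE x in M. (norm (f x))\<^sup>2 \<le> g x"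
  shows "L2 M f"
  unfolding L2_def
proof
  show "integrable M (\<lambda>x. (norm (f x))\<^sup>2)"
    by (rule Bochner_Integration.integrable_bound[OF g])
      (use f le in \<open>auto elim!: eventually_mono\<close>)
qed (rule f)

lemma norm_add_sq_le: "(norm (a + b :: complex))\<^sup>2 \<le> 2 * (norm a)\<^sup>2 + 2 * (norm b)\<^sup>2"
proof -
  have "(norm (a + b))\<^sup>2 \<le> (norm a + norm b)\<^sup>2"
    by (intro power_mono norm_triangle_ineq) auto
  also have "\<dots> \<le> 2 * (norm a)\<^sup>2 + 2 * (norm b)\<^sup>2"
    using sum_squares_bound[of "norm a" "norm b"] by (simp add: power2_sum)
  finally show ?thesis .
qed

lemma L2_add: assumes "L2 M f" "L2 M g" shows "L2 M (\<lambda>x. f x + g x)"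
  by (rule L2_bound[where g="\<lambda>x. 2 * (norm (f x))\<^sup>2 + 2 * (norm (g x))\<^sup>2"])
     (use assms norm_add_sq_le in \<open>auto simp: L2_def\<close>)

lemma L2_cmult: assumes "L2 M f" shows "L2 M (\<lambda>x. c * f x)"
  using assms by (auto simp: L2_def norm_mult power_mult_distrib)

lemma L2_zero: "L2 M (\<lambda>x. 0)"
  by (simp add: L2_def)

lemma L2_diff: assumes "L2 M f" "L2 M g" shows "L2 M (\<lambda>x. f x - g x)"
  using L2_add[OF assms(1) L2_cmult[OF assms(2), of "-1"]] by simp

lemma L2_sum: "(\<And>i. i \<in> I \<Longrightarrow> L2 M (f i)) \<Longrightarrow> L2 M (\<lambda>x. \<Sum>i\<in>I. f i x)"
  by (induction I rule: infinite_finite_induct) (auto simp: L2_zero intro!: L2_add)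

lemma measurable_cnj [measurable (raw)]:
  "f \<in> borel_measurable M \<Longrightarrow> (\<lambda>x. cnj (f x)) \<in> borel_measurable M"
  by (rule borel_measurable_continuous_on[where f=cnj]) (intro continuous_intros)

lemma L2_cnj: "L2 M f \<Longrightarrow> L2 M (\<lambda>x. cnj (f x))"
  by (auto simp: L2_def)

lemma L2_mult_bounded:
  assumes f: "L2 M f" and g: "g \<in> borel_measurable M" "AE x in M. norm (g x) \<le> C"
  shows "L2 M (\<lambda>x. f x * g x)"
proof (rule L2_bound[where g="\<lambda>x. C\<^sup>2 * (norm (f x))\<^sup>2"])
  show "AE x in M. (norm (f x * g x))\<^sup>2 \<le> C\<^sup>2 * (norm (f x))\<^sup>2"
    using g(2)
  proof eventually_elim
    case (elim x)
    then have "(norm (g x))\<^sup>2 \<le> C\<^sup>2" by (intro power_mono) auto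
    then show ?case
      by (simp add: norm_mult power_mult_distrib mult.commute[of "C\<^sup>2"] mult_left_mono)
  qed
qed (use f g in \<open>auto simp: L2_def\<close>)

lemma L2_mult_integrable:
  assumes "L2 M f" "L2 M g" shows "integrable M (\<lambda>x. f x * g x)"
proof (rule Bochner_Integration.integrable_bound[where f="\<lambda>x. (norm (f x))\<^sup>2 + (norm (g x))\<^sup>2"])
  have "norm (f x * g x) \<le> (norm (f x))\<^sup>2 + (norm (g x))\<^sup>2" for x
  proof -
    have "0 \<le> norm (f x) * norm (g x)" by simp
    moreover have "2 * (norm (f x) * norm (g x)) \<le> (norm (f x))\<^sup>2 + (norm (g x))\<^sup>2"
      using sum_squares_bound[of "norm (f x)" "norm (g x)"] by (simp only: mult.assoc)
    ultimately show ?thesis unfolding norm_mult by linarith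
  qed
  then show "AE x in M. norm (f x * g x) \<le> norm ((norm (f x))\<^sup>2 + (norm (g x))\<^sup>2)"
    by auto
qed (use assms in \<open>auto simp: L2_def\<close>)

lemma (in finite_measure) L2_const: "L2 M (\<lambda>x. c)"
  by (simp add: L2_def)

lemma (in finite_measure) L2_bounded:
  assumes "f \<in> borel_measurable M" "AE x in M. norm (f x) \<le> C" shows "L2 M f"
  using L2_mult_bounded[OF L2_const[of 1] assms] by simp

lemma (in finite_measure) L2_integrable: "L2 M f \<Longrightarrow> integrable M f"
  using L2_mult_integrable[OF _ L2_const[of 1], of f] by simp

text \<open>The weighted inequality \<open>a * b <= 1 / (2*d) * a^2 + d / 2 * b^2\<close> takes the
  place of Cauchy-Schwarz, so that only integrals of squares have to be estimated.\<close>

lemma L2_tendsto_integral: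
  assumes L2: "\<And>n. L2 M (f n)" "L2 M F" "L2 M g"
    and lim: "(\<lambda>n. \<integral>x. (norm (f n x - F x))\<^sup>2 \<partial>M) \<longlonglongrightarrow> 0"
  shows "(\<lambda>n. \<integral>x. f n x * g x \<partial>M) \<longlonglongrightarrow> (\<integral>x. F x * g x \<partial>M)"
proof (rule LIMSEQ_I)
  fix e :: real assume e: "e > 0"
  define G where "G = (\<integral>x. (norm (g x))\<^sup>2 \<partial>M)"
  have G: "G \<ge> 0" by (simp add: G_def)
  \<comment> \<open>This weight makes \<open>d / 2 * G\<close> smaller than \<open>e / 2\<close>;
    the other half of \<open>e\<close> is reached once the squared distance is below
    \<open>d * e\<close>. The summand 1 covers \<open>G = 0\<close>.\<close>
  define d where "d = e / (G + 1)"
  have d: "d > 0" using e G by (simp add: d_def)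
  have "d * G < e" using e G by (simp add: d_def field_simps)
  have "d * e > 0" using d e by simp
  then obtain N where N: "\<And>n. n \<ge> N \<Longrightarrow> (\<integral>x. (norm (f n x - F x))\<^sup>2 \<partial>M) < d * e"
    using LIMSEQ_D[OF lim, of "d * e"] by (auto simp: abs_less_iff)
  show "\<exists>no. \<forall>n\<ge>no. norm ((\<integral>x. f n x * g x \<partial>M) - (\<integral>x. F x * g x \<partial>M)) < e"
  proof (intro exI allI impI)
    fix n assume n: "N \<le> n"
    let ?D = "\<lambda>x. f n x - F x"
    have D: "L2 M ?D" by (intro L2_diff L2)
    have pw: "norm (?D x * g x) \<le> 1 / (2*d) * (norm (?D x))\<^sup>2 + d / 2 * (norm (g x))\<^sup>2" for x
    proof -
      have "a * b \<le> 1 / (2*d) * a\<^sup>2 + d / 2 * b\<^sup>2" for a b :: real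
      proof -
        have "0 \<le> (a - d * b)\<^sup>2" by simp
        then show ?thesis using d by (simp add: power2_diff field_simps power2_eq_square)
      qed
      then show ?thesis by (simp only: norm_mult)
    qed
    have "norm ((\<integral>x. f n x * g x \<partial>M) - (\<integral>x. F x * g x \<partial>M)) = norm (\<integral>x. ?D x * g x \<partial>M)"
      by (simp add: left_diff_distrib Bochner_Integration.integral_diff L2_mult_integrable L2)
    also have "\<dots> \<le> (\<integral>x. norm (?D x * g x) \<partial>M)" by (rule integral_norm_bound)
    also have "\<dots> \<le> (\<integral>x. 1 / (2*d) * (norm (?D x))\<^sup>2 + d / 2 * (norm (g x))\<^sup>2 \<partial>M)"
      by (rule integral_mono) (use L2_mult_integrable[OF D L2(3)] D L2(3) pw in \<open>auto simp: L2_def\<close>)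
    also have "\<dots> = 1 / (2*d) * (\<integral>x. (norm (?D x))\<^sup>2 \<partial>M) + d / 2 * G"
      using D L2(3) by (simp add: G_def L2_def)
    also have "\<dots> < 1 / (2*d) * (d * e) + e / 2"
      using N[OF n] d \<open>d * G < e\<close> by (intro add_strict_mono mult_strict_left_mono) auto
    also have "\<dots> = e" using d by simp
    finally show "norm ((\<integral>x. f n x * g x \<partial>M) - (\<integral>x. F x * g x \<partial>M)) < e" .
  qed
qed

text \<open>The geometric rate makes the sequence converge almost everywhere without passing to a subsequence.\<close>

lemma L2_complete:
  assumes fin: "finite_measure M" and f: "\<And>n. L2 M (f n)"
    and rate: "\<And>n k. n \<le> k \<Longrightarrow> (\<integral>x. (norm (f k x - f n x))\<^sup>2 \<partial>M) \<le> C / 4 ^ n"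
  obtains F where "L2 M F" "(\<lambda>n. \<integral>x. (norm (f n x - F x))\<^sup>2 \<partial>M) \<longlonglongrightarrow> 0"
proof -
  note [measurable] = L2_measurable[OF f]
  have int: "integrable M (\<lambda>x. (norm (f k x - f n x))\<^sup>2)" for k n
    using L2_diff[OF f f] by (simp add: L2_def)
  have nnrate: "(\<integral>\<^sup>+x. ennreal ((norm (f k x - f n x))\<^sup>2) \<partial>M) \<le> ennreal (C / 4 ^ n)" if "n \<le> k" for n k
    by (subst nn_integral_eq_integral[OF int]) (use rate[OF that] in \<open>auto intro: ennreal_leI\<close>)
  have C: "C \<ge> 0"
    using rate[of 0 0] by simp
  \<comment> \<open>The weight \<open>2 ^ n\<close> is light enough that the integrals still form a
    geometric series of ratio 1/2, and heavy enough that convergence of the weighted squares at a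
    point forces the increments themselves to be summable.\<close>
  let ?D = "\<lambda>n x. (2::real) ^ n * (norm (f (Suc n) x - f n x))\<^sup>2"
  have "(\<integral>\<^sup>+x. (\<Sum>n. ennreal (?D n x)) \<partial>M) = (\<Sum>n. \<integral>\<^sup>+x. ennreal (?D n x) \<partial>M)"
    by (rule nn_integral_suminf) measurable
  also have "\<dots> \<le> (\<Sum>n. ennreal (C * (1/2) ^ n))"
  proof (rule suminf_le)
    fix n
    have "(\<integral>\<^sup>+x. ennreal (?D n x) \<partial>M) = ennreal (2^n) * (\<integral>\<^sup>+x. ennreal ((norm (f (Suc n) x - f n x))\<^sup>2) \<partial>M)"
      by (simp add: ennreal_mult nn_integral_cmult)
    also have "\<dots> \<le> ennreal (2^n) * ennreal (C / 4 ^ n)"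
      by (intro mult_left_mono nnrate) auto
    also have "\<dots> = ennreal (C * (1/2) ^ n)"
      using C by (simp add: ennreal_mult[symmetric] field_simps power_mult_distrib[symmetric])
    finally show "(\<integral>\<^sup>+x. ennreal (?D n x) \<partial>M) \<le> ennreal (C * (1/2) ^ n)" .
  qed auto
  also have "\<dots> < \<infinity>"
    using C by (subst suminf_ennreal2) (auto intro!: summable_mult summable_geometric)
  finally have fin_sum: "(\<integral>\<^sup>+x. (\<Sum>n. ennreal (?D n x)) \<partial>M) \<noteq> \<infinity>"
    by simp
  have "AE x in M. (\<Sum>n. ennreal (?D n x)) \<noteq> \<infinity>"
    by (rule nn_integral_PInf_AE[OF _ fin_sum]) measurable
  then have conv: "AE x in M. convergent (\<lambda>n. f n x)"
  proof eventually_elim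
    case (elim x)
    have s: "summable (\<lambda>n. ?D n x)"
      by (rule summable_suminf_not_top) (use elim in auto)
    have "summable (\<lambda>n. f (Suc n) x - f n x)"
    proof (rule summable_comparison_test')
      show "summable (\<lambda>n. (1/2)^n + ?D n x)"
        by (intro summable_add s summable_geometric) auto
      fix n :: nat
      let ?d = "norm (f (Suc n) x - f n x)"
      have "0 \<le> (1 - 2^n * ?d)\<^sup>2" by simp
      then have "2 * (2^n * ?d) \<le> 1 + 2^n * (2^n * ?d\<^sup>2)"
        by (simp add: power2_diff power_mult_distrib power2_eq_square algebra_simps)
      then have "2 * ?d \<le> (1/2)^n + ?D n x"
        by (simp add: field_simps)
      then show "norm (f (Suc n) x - f n x) \<le> (1/2)^n + ?D n x"
        using norm_ge_zero[of "f (Suc n) x - f n x"] by linarith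
    qed
    then have "convergent (\<lambda>n. (\<Sum>i<n. f (Suc i) x - f i x) + f 0 x)"
      by (intro convergent_add convergent_const) (simp add: summable_iff_convergent)
    then show ?case by (simp add: sum_lessThan_telescope[of "\<lambda>n. f n x" for x])
  qed
  define F where "F x = lim (\<lambda>n. f n x)" for x
  have [measurable]: "F \<in> borel_measurable M"
    unfolding F_def by measurable
  \<comment> \<open>Fatou's lemma in the index \<open>k\<close> carries the rate over to the limit
    function.\<close>
  have bound: "(\<integral>\<^sup>+x. ennreal ((norm (F x - f n x))\<^sup>2) \<partial>M) \<le> ennreal (C / 4 ^ n)" for n
  proof -
    have "(\<integral>\<^sup>+x. ennreal ((norm (F x - f n x))\<^sup>2) \<partial>M)
        = (\<integral>\<^sup>+x. liminf (\<lambda>k. ennreal ((norm (f k x - f n x))\<^sup>2)) \<partial>M)"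
    proof (rule nn_integral_cong_AE)
      show "AE x in M. ennreal ((norm (F x - f n x))\<^sup>2) = liminf (\<lambda>k. ennreal ((norm (f k x - f n x))\<^sup>2))"
        using conv
      proof eventually_elim
        case (elim x)
        then have "(\<lambda>k. f k x) \<longlonglongrightarrow> F x"
          by (simp add: F_def convergent_LIMSEQ_iff)
        then have "(\<lambda>k. ennreal ((norm (f k x - f n x))\<^sup>2)) \<longlonglongrightarrow> ennreal ((norm (F x - f n x))\<^sup>2)"
          by (intro tendsto_intros) auto
        from lim_imp_Liminf[OF _ this] show ?case by simp
      qed
    qed
    also have "\<dots> \<le> liminf (\<lambda>k. \<integral>\<^sup>+x. ennreal ((norm (f k x - f n x))\<^sup>2) \<partial>M)"
      by (rule nn_integral_liminf) measurable
    also have "\<dots> \<le> liminf (\<lambda>k. ennreal (C / 4 ^ n))"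
      by (rule Liminf_mono) (use nnrate in \<open>auto simp: eventually_at_top_linorder\<close>)
    also have "\<dots> = ennreal (C / 4 ^ n)" by (simp add: Liminf_const)
    finally show ?thesis .
  qed
  have L2d: "L2 M (\<lambda>x. F x - f n x)" for n
    unfolding L2_def integrable_iff_bounded
    using le_less_trans[OF bound ennreal_less_top] by auto
  have "L2 M (\<lambda>x. (F x - f 0 x) + f 0 x)"
    by (intro L2_add L2d f)
  then have L2F: "L2 M F" by simp
  have "(\<lambda>n. \<integral>x. (norm (f n x - F x))\<^sup>2 \<partial>M) \<longlonglongrightarrow> 0"
  proof (rule tendsto_sandwich[where f="\<lambda>_. 0"])
    show "\<forall>\<^sub>F n in sequentially. (\<integral>x. (norm (f n x - F x))\<^sup>2 \<partial>M) \<le> C * (1/4) ^ n"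
    proof (rule always_eventually, rule allI)
      fix n
      have "ennreal (\<integral>x. (norm (F x - f n x))\<^sup>2 \<partial>M) \<le> ennreal (C / 4 ^ n)"
        using bound[of n] L2d[of n] by (subst nn_integral_eq_integral[symmetric]) (auto simp: L2_def)
      then have "(\<integral>x. (norm (F x - f n x))\<^sup>2 \<partial>M) \<le> C / 4 ^ n"
        using C by (simp add: ennreal_le_iff)
      then show "(\<integral>x. (norm (f n x - F x))\<^sup>2 \<partial>M) \<le> C * (1/4) ^ n"
        by (simp add: norm_minus_commute power_divide)
    qed
    show "(\<lambda>n. C * (1/4) ^ n) \<longlonglongrightarrow> 0"
      by (intro tendsto_mult_right_zero LIMSEQ_power_zero) auto
  qed auto
  with L2F show ?thesis by (rule that)
qed

text \<open>This is the Hilbert space projection theorem for m-tuples: \<open>\<G>\<close> lists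
  continuous linear functionals with prescribed values, \<open>u0\<close> witnesses that they are
  consistent, and \<open>u\<close> is the limit of a minimising sequence. The constraints pair
  without conjugation, so that Fourier coefficients are instances of them.\<close>

lemma affine_L2_minimal:
  fixes \<G> :: "((nat \<Rightarrow> 'a \<Rightarrow> complex) \<times> complex) set"
  assumes fin: "finite_measure M"
    and G: "\<And>G c j. (G, c) \<in> \<G> \<Longrightarrow> j < m \<Longrightarrow> L2 M (G j)"
    and u0: "\<And>j. j < m \<Longrightarrow> L2 M (u0 j)" "\<And>G c. (G, c) \<in> \<G> \<Longrightarrow> (\<Sum>j<m. \<integral>x. u0 j x * G j x \<partial>M) = c"
  shows "\<exists>u. (\<forall>j<m. L2 M (u j)) \<and>
    (\<forall>G c. (G, c) \<in> \<G> \<longrightarrow> (\<Sum>j<m. \<integral>x. u j x * G j x \<partial>M) = c) \<and>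
    (\<forall>v. (\<forall>j<m. L2 M (v j)) \<and> (\<forall>G c. (G, c) \<in> \<G> \<longrightarrow> (\<Sum>j<m. \<integral>x. v j x * G j x \<partial>M) = 0)
       \<longrightarrow> (\<Sum>j<m. \<integral>x. u j x * cnj (v j x) \<partial>M) = 0)"
proof -
  define A where "A = {u. (\<forall>j<m. L2 M (u j)) \<and> (\<forall>G c. (G, c) \<in> \<G> \<longrightarrow> (\<Sum>j<m. \<integral>x. u j x * G j x \<partial>M) = c)}"
  define N where "N u = (\<Sum>j<m. \<integral>x. (norm (u j x))\<^sup>2 \<partial>M)" for u :: "nat \<Rightarrow> 'a \<Rightarrow> complex"
  have N_nonneg: "N u \<ge> 0" for u unfolding N_def by (intro sum_nonneg) auto
  have A_L2: "L2 M (u j)" if "u \<in> A" "j < m" for u j using that by (auto simp: A_def)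
  have "u0 \<in> A" using u0 by (auto simp: A_def)
  define d where "d = Inf (N ` A)"
  have bdd: "bdd_below (N ` A)" using N_nonneg by (auto intro!: bdd_belowI[of _ 0])
  have d_le: "d \<le> N u" if "u \<in> A" for u
    unfolding d_def by (rule cInf_lower[OF _ bdd]) (use that in auto)
  have "\<exists>u\<in>A. N u < d + (1/4)^n" for n :: nat
  proof -
    have "Inf (N ` A) < d + (1/4)^n" by (simp add: d_def)
    then show ?thesis using \<open>u0 \<in> A\<close> by (subst (asm) cInf_less_iff[OF _ bdd]) auto
  qed
  \<comment> \<open>By the parallelogram law, a gap of \<open>(1/4)^n\<close> to the infimum gives
    squared distances of at most \<open>4 / 4 ^ n\<close>, the rate required for
    completeness.\<close>
  then obtain f where fA: "\<And>n. f n \<in> A" and fN: "\<And>n::nat. N (f n) < d + (1/4)^n" by metis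
  have mid: "(\<lambda>j x. (u j x + v j x) / 2) \<in> A" if "u \<in> A" "v \<in> A" for u v
    unfolding A_def
  proof (clarsimp, intro conjI ballI allI impI, goal_cases)
    case (1 j)
    then show ?case using L2_cmult[OF L2_add[OF A_L2[OF that(1)] A_L2[OF that(2)]], of j j "1/2"]
      by simp
  next
    case (2 G c)
    have "(\<Sum>j<m. \<integral>x. (u j x + v j x) * G j x / 2 \<partial>M)
        = (\<Sum>j<m. ((\<integral>x. u j x * G j x \<partial>M) + (\<integral>x. v j x * G j x \<partial>M)) / 2)"
      using A_L2[OF that(1)] A_L2[OF that(2)] G 2
      by (intro sum.cong refl) (simp add: distrib_right L2_mult_integrable)
    also have "\<dots> = c"
      using 2 that by (auto simp: A_def sum.distrib sum_divide_distrib[symmetric])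
    finally show ?case by simp
  qed
  have par: "N (\<lambda>j x. u j x - v j x) = 2 * N u + 2 * N v - 4 * N (\<lambda>j x. (u j x + v j x) / 2)"
    if "u \<in> A" "v \<in> A" for u v
  proof -
    have "(\<integral>x. (norm (u j x - v j x))\<^sup>2 \<partial>M) = 2 * (\<integral>x. (norm (u j x))\<^sup>2 \<partial>M) + 2 * (\<integral>x. (norm (v j x))\<^sup>2 \<partial>M)
        - 4 * (\<integral>x. (norm ((u j x + v j x) / 2))\<^sup>2 \<partial>M)" if j: "j < m" for j
    proof -
      have i: "integrable M (\<lambda>x. (norm (u j x))\<^sup>2)" "integrable M (\<lambda>x. (norm (v j x))\<^sup>2)"
        "integrable M (\<lambda>x. (norm ((u j x + v j x) / 2))\<^sup>2)"
        using A_L2[OF \<open>u \<in> A\<close> j] A_L2[OF \<open>v \<in> A\<close> j] A_L2[OF mid[OF \<open>u \<in> A\<close> \<open>v \<in> A\<close>] j] by (auto simp: L2_def)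
      have pw: "(norm (a - b))\<^sup>2 = 2 * (norm a)\<^sup>2 + 2 * (norm b)\<^sup>2 - 4 * (norm ((a + b) / 2))\<^sup>2" for a b :: complex
        unfolding cmod_power2 by (simp add: power2_eq_square field_simps)
      have "(\<integral>x. (norm (u j x - v j x))\<^sup>2 \<partial>M) =
          (\<integral>x. 2 * (norm (u j x))\<^sup>2 + 2 * (norm (v j x))\<^sup>2 - 4 * (norm ((u j x + v j x) / 2))\<^sup>2 \<partial>M)"
        by (simp only: pw)
      also have "\<dots> = 2 * (\<integral>x. (norm (u j x))\<^sup>2 \<partial>M) + 2 * (\<integral>x. (norm (v j x))\<^sup>2 \<partial>M)
        - 4 * (\<integral>x. (norm ((u j x + v j x) / 2))\<^sup>2 \<partial>M)"
        using i by (subst Bochner_Integration.integral_diff, simp, simp)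
          (subst Bochner_Integration.integral_add; simp del: norm_divide)
      finally show ?thesis .
    qed
    then show ?thesis
      by (simp add: N_def sum.distrib sum_subtractf sum_distrib_left del: norm_divide)
  qed
  have rate: "N (\<lambda>j x. f k j x - f n j x) \<le> 4 / 4 ^ n" if "n \<le> k" for n k
  proof -
    have "d \<le> N (\<lambda>j x. (f k j x + f n j x) / 2)"
      by (intro d_le mid fA)
    moreover have "(1/4::real)^k \<le> (1/4)^n" by (rule power_decreasing) (use that in auto)
    ultimately show ?thesis
      using fN[of n] fN[of k] by (simp add: par[OF fA fA] power_divide del: norm_divide)
  qed
  have comp: "\<exists>F. L2 M F \<and> (\<lambda>n. \<integral>x. (norm (f n j x - F x))\<^sup>2 \<partial>M) \<longlonglongrightarrow> 0" if j: "j < m" for j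
  proof -
    have "(\<integral>x. (norm (f k j x - f n j x))\<^sup>2 \<partial>M) \<le> 4 / 4 ^ n" if "n \<le> k" for n k
    proof -
      have "(\<integral>x. (norm (f k j x - f n j x))\<^sup>2 \<partial>M) \<le> N (\<lambda>j x. f k j x - f n j x)"
        unfolding N_def
        by (rule member_le_sum[of j _ "\<lambda>j. \<integral>x. (norm (f k j x - f n j x))\<^sup>2 \<partial>M"]) (use j in auto)
      with rate[OF that] show ?thesis by linarith
    qed
    from L2_complete[OF fin A_L2[OF fA j] this] show ?thesis by blast
  qed
  then have "\<forall>j\<in>{..<m}. \<exists>F. L2 M F \<and> (\<lambda>n. \<integral>x. (norm (f n j x - F x))\<^sup>2 \<partial>M) \<longlonglongrightarrow> 0"
    by simp
  from bchoice[OF this] obtain u where "\<forall>j\<in>{..<m}. L2 M (u j) \<and> (\<lambda>n. \<integral>x. (norm (f n j x - u j x))\<^sup>2 \<partial>M) \<longlonglongrightarrow> 0"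
    by blast
  then have u: "\<And>j. j < m \<Longrightarrow> L2 M (u j)"
      and lim: "\<And>j. j < m \<Longrightarrow> (\<lambda>n. \<integral>x. (norm (f n j x - u j x))\<^sup>2 \<partial>M) \<longlonglongrightarrow> 0"
    by auto
  have lim_ip: "(\<lambda>n. \<Sum>j<m. \<integral>x. f n j x * h j x \<partial>M) \<longlonglongrightarrow> (\<Sum>j<m. \<integral>x. u j x * h j x \<partial>M)"
    if "\<And>j. j < m \<Longrightarrow> L2 M (h j)" for h
    by (intro tendsto_sum L2_tendsto_integral A_L2 fA u lim that) auto
  show ?thesis
  proof (intro exI[of _ u] conjI allI impI)
    show "L2 M (u j)" if "j < m" for j by (rule u[OF that])
    show "(\<Sum>j<m. \<integral>x. u j x * G j x \<partial>M) = c" if "(G, c) \<in> \<G>" for G c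
    proof (rule LIMSEQ_unique[OF lim_ip])
      show "(\<lambda>n. \<Sum>j<m. \<integral>x. f n j x * G j x \<partial>M) \<longlonglongrightarrow> c"
        using fA that by (auto simp: A_def)
    qed (use G that in auto)
    show "(\<Sum>j<m. \<integral>x. u j x * cnj (v j x) \<partial>M) = 0"
      if hom: "(\<forall>j<m. L2 M (v j)) \<and> (\<forall>G c. (G, c) \<in> \<G> \<longrightarrow> (\<Sum>j<m. \<integral>x. v j x * G j x \<partial>M) = 0)" for v
    proof -
      have v: "\<And>j. j < m \<Longrightarrow> L2 M (v j)"
        and v0: "\<And>G c. (G, c) \<in> \<G> \<Longrightarrow> (\<Sum>j<m. \<integral>x. v j x * G j x \<partial>M) = 0"
        using hom by auto
      define I where "I = (\<Sum>j<m. \<integral>x. u j x * cnj (v j x) \<partial>M)"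
      \<comment> \<open>The variation is carried out at the terms \<open>f n\<close>, with error
        \<open>(1/4)^n\<close>, and then passed to the limit, so only convergence of inner products
        is used.\<close>
      have step: "0 \<le> 2 * Re (cnj c * I) + (norm c)\<^sup>2 * N v" for c
      proof -
        have mem: "(\<lambda>j x. f n j x + c * v j x) \<in> A" for n
          unfolding A_def
        proof (clarsimp, intro conjI ballI allI impI, goal_cases)
          case (1 j)
          then show ?case by (intro L2_add L2_cmult v A_L2 fA)
        next
          case (2 G b)
          have "(\<Sum>j<m. \<integral>x. (f n j x + c * v j x) * G j x \<partial>M)
              = (\<Sum>j<m. (\<integral>x. f n j x * G j x \<partial>M) + c * (\<integral>x. v j x * G j x \<partial>M))"
            using A_L2[OF fA] v G 2
            by (intro sum.cong refl) (simp add: distrib_right mult.assoc L2_mult_integrable)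
          also have "\<dots> = b"
            using 2 fA[of n] v0 by (auto simp: A_def sum.distrib sum_distrib_left[symmetric])
          finally show ?case by simp
        qed
        have exp: "N (\<lambda>j x. f n j x + c * v j x) = N (f n)
            + 2 * Re (cnj c * (\<Sum>j<m. \<integral>x. f n j x * cnj (v j x) \<partial>M)) + (norm c)\<^sup>2 * N v" for n
        proof -
          have "(\<integral>x. (norm (f n j x + c * v j x))\<^sup>2 \<partial>M) = (\<integral>x. (norm (f n j x))\<^sup>2 \<partial>M)
              + 2 * Re (cnj c * (\<integral>x. f n j x * cnj (v j x) \<partial>M)) + (norm c)\<^sup>2 * (\<integral>x. (norm (v j x))\<^sup>2 \<partial>M)"
            if j: "j < m" for j
          proof -
            have i: "integrable M (\<lambda>x. (norm (f n j x))\<^sup>2)" "integrable M (\<lambda>x. (norm (v j x))\<^sup>2)"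
              "integrable M (\<lambda>x. f n j x * cnj (v j x))"
              using A_L2[OF fA j] v[OF j] by (auto simp: L2_def intro!: L2_mult_integrable L2_cnj A_L2 fA j v)
            then have i': "integrable M (\<lambda>x. cnj c * (f n j x * cnj (v j x)))" by simp
            have pw: "(norm (a + c * b))\<^sup>2 = (norm a)\<^sup>2 + 2 * Re (cnj c * (a * cnj b)) + (norm c)\<^sup>2 * (norm b)\<^sup>2" for a b
              unfolding cmod_power2 by (simp add: power2_eq_square algebra_simps)
            have "(\<integral>x. (norm (f n j x + c * v j x))\<^sup>2 \<partial>M) =
              (\<integral>x. (norm (f n j x))\<^sup>2 + 2 * Re (cnj c * (f n j x * cnj (v j x))) + (norm c)\<^sup>2 * (norm (v j x))\<^sup>2 \<partial>M)"
              by (simp only: pw)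
            also have "\<dots> = (\<integral>x. (norm (f n j x))\<^sup>2 \<partial>M)
              + 2 * (\<integral>x. Re (cnj c * (f n j x * cnj (v j x))) \<partial>M) + (norm c)\<^sup>2 * (\<integral>x. (norm (v j x))\<^sup>2 \<partial>M)"
              using i integrable_Re[OF i']
              by (simp del: mult_cancel_left times_complex.sel)
            also have "(\<integral>x. Re (cnj c * (f n j x * cnj (v j x))) \<partial>M) = Re (cnj c * (\<integral>x. f n j x * cnj (v j x) \<partial>M))"
              by (subst integral_Re[OF i']) simp
            finally show ?thesis .
          qed
          then show ?thesis
            by (simp add: N_def sum.distrib sum_distrib_left del: times_complex.sel)
        qed
        have "d \<le> (d + (1/4)^n) + 2 * Re (cnj c * (\<Sum>j<m. \<integral>x. f n j x * cnj (v j x) \<partial>M)) + (norm c)\<^sup>2 * N v" for n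
          using d_le[OF mem[of n]] fN[of n] unfolding exp by linarith
        moreover have "(\<lambda>n. (d + (1/4)^n) + 2 * Re (cnj c * (\<Sum>j<m. \<integral>x. f n j x * cnj (v j x) \<partial>M)) + (norm c)\<^sup>2 * N v)
          \<longlonglongrightarrow> (d + 0) + 2 * Re (cnj c * I) + (norm c)\<^sup>2 * N v"
          unfolding I_def
          by (intro tendsto_intros LIMSEQ_power_zero lim_ip L2_cnj v) auto
        ultimately have "d \<le> (d + 0) + 2 * Re (cnj c * I) + (norm c)\<^sup>2 * N v"
          by (intro LIMSEQ_le_const) auto
        then show ?thesis by simp
      qed
      \<comment> \<open>For \<open>c = - s * I\<close> the inequality reads
        \<open>s * (norm I)^2 * (s * N v - 2) >= 0\<close>; since \<open>s * N v < 1\<close>, the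
        last factor is negative and \<open>I\<close> must vanish.\<close>
      define s where "s = 1 / (N v + 1)"
      have s: "s > 0" "s * N v < 1" using N_nonneg[of v] by (auto simp: s_def field_simps)
      have eq: "Re (cnj (- s * I) * I) = - s * (norm I)\<^sup>2" "(norm (- s * I))\<^sup>2 = s\<^sup>2 * (norm I)\<^sup>2"
        unfolding cmod_power2 by (simp_all add: power2_eq_square algebra_simps)
      have "0 \<le> 2 * Re (cnj (- s * I) * I) + (norm (- s * I))\<^sup>2 * N v" by (rule step)
      also have "\<dots> = s * (norm I)\<^sup>2 * (s * N v - 2)"
        unfolding eq by (simp add: power2_eq_square algebra_simps)
      finally have "s * (norm I)\<^sup>2 * (s * N v - 2) \<ge> 0" .
      moreover have "s * N v - 2 < 0" using s by simp
      ultimately have "s * (norm I)\<^sup>2 \<le> 0"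
        by (metis mult_pos_neg not_less)
      then have "I = 0" using s(1)
        by (simp add: mult_le_0_iff)
      then show ?thesis by (simp add: I_def)
    qed
  qed
qed

section \<open>Fourier coefficients on the circle\<close>

text \<open>The largest \<open>\<sigma>\<close>-algebra for which \<open>circ\<close> is measurable makes measurability and null sets on the circle agree
  with \<open>meas_T\<close> and \<open>AE_T\<close>, including for sets that are Lebesgue but not Borel measurable.\<close>

definition CT :: "complex measure" where
  "CT = distr Tmeas (sigma (sphere 0 1) {A. A \<subseteq> sphere 0 1 \<and> circ -` A \<inter> {0..1} \<in> sets Tmeas}) circ"

lemma norm_circ [simp]: "norm (circ t) = 1"
  by (simp add: circ_def)

lemma continuous_on_circ [continuous_intros]: "continuous_on S circ"
  unfolding circ_def by (intro continuous_intros)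

lemma space_CT [simp]: "space CT = sphere 0 1"
  by (simp add: CT_def space_measure_of_conv)

lemma sets_CT: "sets CT = sigma_sets (sphere 0 1) {A. A \<subseteq> sphere 0 1 \<and> circ -` A \<inter> {0..1} \<in> sets Tmeas}"
  unfolding CT_def by (simp add: sets_measure_of subset_eq)

lemma measurable_circ:
  "circ \<in> measurable Tmeas (sigma (sphere 0 1) {A. A \<subseteq> sphere 0 1 \<and> circ -` A \<inter> {0..1} \<in> sets Tmeas})"
  by (rule measurable_measure_of) auto

lemma measurable_circ_CT [measurable]: "circ \<in> measurable Tmeas CT"
  using measurable_circ by (simp add: CT_def)

lemma CT_setsI: "A \<subseteq> sphere 0 1 \<Longrightarrow> circ -` A \<inter> {0..1} \<in> sets Tmeas \<Longrightarrow> A \<in> sets CT"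
  unfolding sets_CT by (intro sigma_sets.Basic) auto

lemma CT_null_iff:
  assumes "A \<in> sets CT" shows "A \<in> null_sets CT \<longleftrightarrow> circ -` A \<inter> {0..1} \<in> null_sets Tmeas"
  using null_sets_distr_iff[OF measurable_circ, of A] assms
  unfolding CT_def[symmetric] by (auto simp: CT_def)

lemma emeasure_space_CT: "emeasure CT (space CT) = 1"
  unfolding space_CT using emeasure_distr[OF measurable_circ, of "sphere 0 1"]
  by (auto simp: CT_def emeasure_restrict_space vimage_def)

interpretation CT: finite_measure CT
  by (rule finite_measureI) (simp add: emeasure_space_CT del: space_CT)

text \<open>From left to right, the exceptional parameter set is only known to lie inside a null
  set. Completeness of Lebesgue measure makes it measurable, and then its image qualifies as a set
  of \<open>CT\<close>.\<close>

lemma AE_T_iff: "AE_T P \<longleftrightarrow> (AE z in CT. P z)"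
proof
  assume "AE z in CT. P z"
  then show "AE_T P"
    unfolding AE_T_def CT_def by (rule AE_distrD[OF measurable_circ])
next
  assume "AE_T P"
  then have "AE t in Tmeas. P (circ t)" by (simp add: AE_T_def)
  then obtain N where N: "N \<in> null_sets Tmeas" "{t \<in> {0..1}. \<not> P (circ t)} \<subseteq> N"
    by (auto elim!: AE_E simp: null_sets_def)
  then have "N \<in> null_sets lebesgue" "N \<subseteq> {0..1}"
    by (auto simp: null_sets_restrict_space)
  with N have "{t \<in> {0..1}. \<not> P (circ t)} \<in> null_sets lebesgue"
    using completion.complete2 by blast
  then have null: "{t \<in> {0..1}. \<not> P (circ t)} \<in> null_sets Tmeas"
    by (auto simp: null_sets_restrict_space)
  have eq: "circ -` {z \<in> sphere 0 1. \<not> P z} \<inter> {0..1} = {t \<in> {0..1}. \<not> P (circ t)}" by auto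
  have "{z \<in> sphere 0 1. \<not> P z} \<in> null_sets CT"
    by (subst CT_null_iff) (use null eq in \<open>auto intro!: CT_setsI\<close>)
  then show "AE z in CT. P z" by (auto intro!: AE_I'[where N="{z \<in> sphere 0 1. \<not> P z}"])
qed

lemma meas_T_iff: "meas_T f \<longleftrightarrow> f \<in> borel_measurable CT"
proof
  assume f: "meas_T f"
  show "f \<in> borel_measurable CT"
  proof (rule measurableI)
    fix B :: "complex set" assume B: "B \<in> sets borel"
    have "(\<lambda>t. f (circ t)) -` B \<inter> space Tmeas \<in> sets Tmeas"
      using f B unfolding meas_T_def by (rule measurable_sets)
    moreover have "(\<lambda>t. f (circ t)) -` B \<inter> space Tmeas = circ -` (f -` B \<inter> space CT) \<inter> {0..1}"
      by auto
    ultimately show "f -` B \<inter> space CT \<in> sets CT" by (intro CT_setsI) auto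
  qed auto
qed (simp add: meas_T_def measurable_compose[OF measurable_circ_CT])

lemma integral_CT:
  fixes f :: "complex \<Rightarrow> 'b::{banach, second_countable_topology}"
  assumes "f \<in> borel_measurable CT"
  shows "integral\<^sup>L CT f = (\<integral>t. f (circ t) \<partial>Tmeas)"
  using integral_distr[OF measurable_circ, of f] assms unfolding CT_def by simp

lemma integrable_CT:
  fixes f :: "complex \<Rightarrow> 'b::{banach, second_countable_topology}"
  assumes "f \<in> borel_measurable CT"
  shows "integrable CT f \<longleftrightarrow> integrable Tmeas (\<lambda>t. f (circ t))"
  using integrable_distr_eq[OF measurable_circ, of f] assms unfolding CT_def by simp

lemma measurable_CT_continuous:
  fixes f :: "complex \<Rightarrow> 'b::topological_space"
  assumes "continuous_on (sphere 0 1) f" shows "f \<in> borel_measurable CT"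
proof (rule borel_measurableI)
  fix B :: "'b set" assume B: "open B"
  have "continuous_on {0..1} (\<lambda>t. f (circ t))"
    by (rule continuous_on_compose2[OF assms continuous_on_circ]) auto
  then have "(\<lambda>t. f (circ t)) \<in> borel_measurable Tmeas"
    by (intro continuous_imp_measurable_on_sets_lebesgue) auto
  then have "(\<lambda>t. f (circ t)) -` B \<inter> space Tmeas \<in> sets Tmeas"
    by (rule measurable_sets) (use B in auto)
  moreover have "(\<lambda>t. f (circ t)) -` B \<inter> space Tmeas = circ -` (f -` B \<inter> space CT) \<inter> {0..1}"
    by auto
  ultimately show "f -` B \<inter> space CT \<in> sets CT" by (intro CT_setsI) auto
qed

lemma measurable_CT_powi [measurable]: "(\<lambda>z. z powi k) \<in> borel_measurable CT"
  by (rule measurable_CT_continuous) (auto intro!: continuous_intros)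

section \<open>Characters of the circle and the calculus of Fourier coefficients\<close>

lemma integrable_mult_powi:
  assumes "integrable CT f" shows "integrable CT (\<lambda>z. f z * z powi k)"
  by (rule Bochner_Integration.integrable_bound[OF assms])
    (use assms in \<open>auto simp: norm_mult norm_power_int\<close>)

lemma L2_mult_powi:
  assumes "L2 CT f" shows "L2 CT (\<lambda>z. f z * z powi k)"
  by (rule L2_mult_bounded[OF assms, where C=1]) (auto simp: norm_power_int)

lemma L2_powi: "L2 CT (\<lambda>z. z powi k)"
  using L2_mult_powi[OF CT.L2_const[of 1]] by simp

lemma powi_add_sphere: "norm (z::complex) = 1 \<Longrightarrow> z powi (j + k) = z powi j * z powi k"
  by (rule power_int_add) auto

lemma cnj_powi_sphere: "norm (z::complex) = 1 \<Longrightarrow> cnj (z powi k) = z powi (- k)"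
proof -
  assume z: "norm z = 1"
  have "cnj z = inverse z" using z by (simp add: inverse_complex_def cmod_def complex_eq_iff)
  then show ?thesis by (simp add: power_int_inverse power_int_minus)
qed

definition fc :: "(complex \<Rightarrow> complex) \<Rightarrow> int \<Rightarrow> complex" where
  "fc f k = (\<integral>z. f z * z powi (- k) \<partial>CT)"

lemma fourier_coeff_eq_fc:
  assumes "f \<in> borel_measurable CT" shows "fourier_coeff f k = fc f k"
proof -
  have "circ t powi (- k) = cis (- 2 * pi * of_int k * t)" for t
    by (simp add: circ_def cis_power_int mult_ac)
  then show ?thesis
    unfolding fc_def fourier_coeff_def
    by (subst integral_CT) (use assms in auto)
qed

lemma fc_shift: "fc (\<lambda>z. f z * z powi j) k = fc f (k - j)"
  unfolding fc_def
  by (rule Bochner_Integration.integral_cong)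
    (auto simp: powi_add_sphere[symmetric] mult.assoc)

lemma fc_add: "integrable CT f \<Longrightarrow> integrable CT g \<Longrightarrow> fc (\<lambda>z. f z + g z) k = fc f k + fc g k"
  by (simp add: fc_def distrib_right integrable_mult_powi)

lemma fc_diff: "integrable CT f \<Longrightarrow> integrable CT g \<Longrightarrow> fc (\<lambda>z. f z - g z) k = fc f k - fc g k"
  by (simp add: fc_def left_diff_distrib integrable_mult_powi)

lemma fc_cmult: "fc (\<lambda>z. c * f z) k = c * fc f k"
  by (simp add: fc_def mult.assoc)

lemma fc_cong_AE:
  assumes "f \<in> borel_measurable CT" "g \<in> borel_measurable CT" "AE z in CT. f z = g z"
  shows "fc f k = fc g k"
  unfolding fc_def by (rule integral_cong_AE) (use assms in auto)

lemma fc_cnj: "fc (\<lambda>z. cnj (f z)) k = cnj (fc f (- k))"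
proof -
  have "fc (\<lambda>z. cnj (f z)) k = (\<integral>z. cnj (f z * z powi k) \<partial>CT)"
    unfolding fc_def
    by (rule Bochner_Integration.integral_cong) (auto simp: cnj_powi_sphere simp del: complex_cnj_power_int)
  also have "\<dots> = cnj (fc f (- k))" unfolding fc_def by (subst Bochner_Integration.integral_cnj) simp
  finally show ?thesis .
qed

lemma integral_powi: "(\<integral>z. z powi k \<partial>CT) = (if k = 0 then 1 else 0)"
proof (cases "k = 0")
  case True
  then show ?thesis using emeasure_space_CT by (simp add: measure_def)
next
  case False
  let ?f = "\<lambda>t. cis (2 * pi * of_int k * t)"
  define c where "c = 2 * pi * of_int k * \<i>"
  have c: "c \<noteq> 0" using False by (simp add: c_def)
  have cis: "cis (2 * pi * of_int k * t) = exp (c * of_real t)" for t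
    by (simp add: c_def cis_conv_exp mult_ac)
  have "((\<lambda>t. exp (c * of_real t)) has_integral exp (c * of_real 1) / c - exp (c * of_real 0) / c) {0..1}"
    by (rule fundamental_theorem_of_calculus)
      (use c in \<open>auto intro!: derivative_eq_intros has_vector_derivative_real_field\<close>)
  also have "exp (c * of_real 1) = cis (2 * pi * of_int k * 1)" by (subst cis) simp
  also have "\<dots> = 1" using cos_int_2pin[of k] sin_int_2pin[of k] by (simp add: complex_eq_iff mult_ac)
  finally have hi: "(?f has_integral 0) {0..1}" by (simp add: cis)
  have pw: "circ t powi k = ?f t" for t
    by (simp add: circ_def cis_power_int mult_ac)
  have "(\<integral>z. z powi k \<partial>CT) = (\<integral>t. ?f t \<partial>Tmeas)"
    by (subst integral_CT) (auto simp: pw)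
  also have "\<dots> = integral {0..1} ?f"
  proof (rule lebesgue_integral_eq_integral)
    show "integrable Tmeas ?f"
      using integrable_CT[of "\<lambda>z. z powi k"] CT.L2_integrable[OF L2_powi[of k]] by (simp add: pw)
  qed auto
  also have "\<dots> = 0" using hi by (rule integral_unique)
  finally show ?thesis using False by simp
qed

lemma fc_powi: "fc (\<lambda>z. z powi j) k = (if j = k then 1 else 0)"
proof -
  have "fc (\<lambda>z. z powi j) k = (\<integral>z. z powi (j - k) \<partial>CT)"
    unfolding fc_def
    by (rule Bochner_Integration.integral_cong) (auto simp: powi_add_sphere[symmetric])
  then show ?thesis by (simp add: integral_powi)
qed

section \<open>Uniqueness of Fourier coefficients, through polynomials, continuous functions and
  closed sets\<close>

lemma fc_zero_polynomial_mult:
  assumes "real_polynomial_function p" "integrable CT h" "\<And>k. fc h k = 0"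
  shows "integrable CT (\<lambda>z. of_real (p z) * h z) \<and> (\<forall>k. fc (\<lambda>z. of_real (p z) * h z) k = 0)"
  using assms
proof (induction arbitrary: h rule: real_polynomial_function.induct)
  case (linear p)
  \<comment> \<open>A real-linear \<open>p\<close> equals \<open>a * z + b * cnj z\<close> with
    these coefficients, and on the circle \<open>cnj z\<close> is \<open>z powi (-1)\<close>.
    Multiplication by \<open>p\<close> thus only combines two shifts of the coefficient
    sequence.\<close>
  define a where "a = (of_real (p 1) - \<i> * of_real (p \<i>)) / 2"
  define b where "b = (of_real (p 1) + \<i> * of_real (p \<i>)) / 2"
  have eq: "of_real (p z) * h z = a * (h z * z powi 1) + b * (h z * z powi (-1))" if "norm z = 1" for z
  proof -
    have "p z = p (Re z *\<^sub>R 1 + Im z *\<^sub>R \<i>)" by (simp add: complex_eq[symmetric] scaleR_conv_of_real mult.commute)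
    also have "\<dots> = Re z * p 1 + Im z * p \<i>"
      using linear(1) by (simp add: bounded_linear.linear linear_add linear_scale)
    finally have p: "p z = Re z * p 1 + Im z * p \<i>" .
    have "of_real (p z) = a * z + b * cnj z"
      by (simp add: p a_def b_def complex_eq_iff field_simps)
    then show ?thesis using cnj_powi_sphere[OF that, of 1] by (simp add: algebra_simps)
  qed
  have i: "integrable CT (\<lambda>z. h z * z powi k)" for k by (rule integrable_mult_powi[OF linear(2)])
  have "integrable CT (\<lambda>z. a * (h z * z powi 1) + b * (h z * z powi (-1)))"
    by (intro Bochner_Integration.integrable_add integrable_mult_right i)
  then have "integrable CT (\<lambda>z. of_real (p z) * h z)"
    by (subst Bochner_Integration.integrable_cong[OF refl eq]) auto
  moreover have "fc (\<lambda>z. of_real (p z) * h z) k = 0" for k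
  proof -
    have "fc (\<lambda>z. of_real (p z) * h z) k = fc (\<lambda>z. a * (h z * z powi 1) + b * (h z * z powi (-1))) k"
      unfolding fc_def by (rule Bochner_Integration.integral_cong) (auto simp: eq)
    also have "\<dots> = 0"
      by (subst fc_add) (use i in \<open>auto simp: fc_cmult fc_shift linear(3) simp del: power_int_1_right power_int_minus1_right\<close>)
    finally show ?thesis .
  qed
  ultimately show ?case by blast
next
  case (const c)
  then show ?case by (simp add: fc_cmult)
next
  case (add f g)
  then show ?case by (simp add: distrib_right fc_add)
next
  case (mult f g)
  then show ?case by (simp add: mult.assoc)
qed

lemma integral_mult_continuous_zero:
  fixes g :: "complex \<Rightarrow> real"
  assumes h: "integrable CT h" "\<And>k. fc h k = 0" and g: "continuous_on (sphere 0 1) g"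
  shows "(\<integral>z. of_real (g z) * h z \<partial>CT) = 0"
proof -
  have "norm (\<integral>z. of_real (g z) * h z \<partial>CT) \<le> e" if e: "e > 0" for e
  proof -
    define H where "H = (\<integral>z. norm (h z) \<partial>CT)"
    have H: "H \<ge> 0" by (simp add: H_def)
    define d where "d = e / (H + 1)"
    have d: "d > 0" "d * H \<le> e" using e H by (auto simp: d_def field_simps)
    obtain p where p: "real_polynomial_function p" "\<And>z. z \<in> sphere 0 1 \<Longrightarrow> \<bar>g z - p z\<bar> < d"
      using Stone_Weierstrass_real_polynomial_function[OF _ g d(1)] by auto
    have ph: "integrable CT (\<lambda>z. of_real (p z) * h z)" "fc (\<lambda>z. of_real (p z) * h z) 0 = 0"
      using fc_zero_polynomial_mult[OF p(1) h] by auto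
    have gm [measurable]: "(\<lambda>z. complex_of_real (g z)) \<in> borel_measurable CT"
      by (rule measurable_CT_continuous) (intro continuous_intros g)
    obtain B where B: "\<And>z. z \<in> sphere 0 1 \<Longrightarrow> norm (g z) \<le> B"
      using compact_imp_bounded[OF compact_continuous_image[OF g compact_sphere]]
      by (metis bounded_iff imageI)
    have gh: "integrable CT (\<lambda>z. of_real (g z) * h z)"
      by (rule Bochner_Integration.integrable_bound[where f="\<lambda>z. B * norm (h z)"])
        (use h B in \<open>auto simp: norm_mult intro!: mult_right_mono order_trans[OF _ abs_ge_self]\<close>)
    have "(\<integral>z. of_real (g z) * h z \<partial>CT) = (\<integral>z. of_real (g z) * h z - of_real (p z) * h z \<partial>CT)"
      using ph gh by (simp add: fc_def)
    also have "norm \<dots> \<le> (\<integral>z. norm (of_real (g z) * h z - of_real (p z) * h z) \<partial>CT)"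
      by (rule integral_norm_bound)
    also have "\<dots> \<le> (\<integral>z. d * norm (h z) \<partial>CT)"
    proof (rule integral_mono)
      fix z assume "z \<in> space CT"
      then have "\<bar>g z - p z\<bar> \<le> d" using p(2)[of z] by simp
      moreover have "norm (of_real (g z) * h z - of_real (p z) * h z) = \<bar>g z - p z\<bar> * norm (h z)"
        by (simp add: left_diff_distrib[symmetric] norm_mult flip: of_real_diff)
      ultimately show "norm (of_real (g z) * h z - of_real (p z) * h z) \<le> d * norm (h z)"
        by (simp add: mult_right_mono)
    qed (use gh ph h in auto)
    also have "\<dots> \<le> e" using d by (simp add: H_def)
    finally show ?thesis .
  qed
  then show ?thesis using field_le_epsilon[of "norm (\<integral>z. of_real (g z) * h z \<partial>CT)" 0] by simp
qed

lemma integral_closed_zero: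
  assumes h: "integrable CT h" "\<And>k. fc h k = 0" and B: "closed B" "B \<subseteq> sphere 0 1" "B \<noteq> {}"
  shows "(\<integral>z. of_real (indicator B z) * h z \<partial>CT) = 0"
proof -
  \<comment> \<open>Continuous tents that equal 1 on \<open>B\<close> and tend to 0 off
    \<open>B\<close>. Nonemptiness of \<open>B\<close> matters here: \<open>infdist\<close> to the
    empty set is 0 by convention, and the tents would be constantly 1.\<close>
  define g where "g n z = max 0 (1 - real n * infdist z B)" for n z
  have gc: "continuous_on (sphere 0 1) (g n)" for n
    unfolding g_def by (intro continuous_intros)
  have [measurable]: "(\<lambda>z. complex_of_real (g n z)) \<in> borel_measurable CT" for n
    by (rule measurable_CT_continuous) (intro continuous_intros gc)
  have g_lim: "(\<lambda>n. g n z) \<longlonglongrightarrow> indicator B z" for z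
  proof (cases "z \<in> B")
    case True
    then show ?thesis by (simp add: g_def)
  next
    case False
    then have "infdist z B > 0" using B by (simp add: infdist_pos_not_in_closed)
    then obtain N :: nat where N: "real N * infdist z B > 1"
      using reals_Archimedean3 by blast
    have "g n z = 0" if "n \<ge> N" for n
    proof -
      have "real N * infdist z B \<le> real n * infdist z B" using that by (intro mult_right_mono infdist_nonneg) auto
      with N show ?thesis by (simp add: g_def)
    qed
    then have "\<forall>\<^sub>F n in sequentially. g n z = 0" by (auto simp: eventually_sequentially)
    with False show ?thesis by (simp add: tendsto_eventually)
  qed
  have Bm: "B \<in> sets CT"
  proof (rule CT_setsI)
    have "closed (circ -` B \<inter> {0..1})"
      by (subst Int_commute, rule continuous_closed_preimage) (auto intro: continuous_intros B)
    then show "circ -` B \<inter> {0..1} \<in> sets Tmeas"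
      by (auto simp: sets_restrict_space_iff)
  qed (use B in auto)
  have "(\<lambda>n. \<integral>z. of_real (g n z) * h z \<partial>CT) \<longlonglongrightarrow> (\<integral>z. of_real (indicator B z) * h z \<partial>CT)"
  proof (rule integral_dominated_convergence[where w="\<lambda>z. norm (h z)"])
    show "AE z in CT. (\<lambda>n. of_real (g n z) * h z) \<longlonglongrightarrow> of_real (indicator B z) * h z"
      by (intro AE_I2 tendsto_intros g_lim)
    show "AE z in CT. norm (of_real (g n z) * h z) \<le> norm (h z)" for n
    proof (intro AE_I2)
      fix z
      have "\<bar>g n z\<bar> \<le> 1" by (auto simp: g_def infdist_nonneg)
      then show "norm (of_real (g n z) * h z) \<le> norm (h z)"
        by (simp add: norm_mult mult_left_le_one_le)
    qed
  qed (use h Bm in auto)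
  moreover have "(\<integral>z. of_real (g n z) * h z \<partial>CT) = 0" for n
    by (rule integral_mult_continuous_zero[OF h gc])
  ultimately show ?thesis by (simp add: LIMSEQ_const_iff)
qed

text \<open>The integral of \<open>h\<close> over any closed subset of the set where
  \<open>Re h > 0\<close> vanishes although the integrand has positive real part there, so every
  such subset is null. Countably many of them exhaust the set up to a null set.\<close>

lemma fc_zero_Re_nonpos:
  assumes h: "integrable CT h" "\<And>k. fc h k = 0"
  shows "AE z in CT. Re (h z) \<le> 0"
proof -
  let ?A = "{z \<in> sphere 0 1. Re (h z) > 0}"
  have hm [measurable]: "h \<in> borel_measurable CT" using h by auto
  have "?A = {z \<in> space CT. Re (h z) > 0}" by simp
  then have A: "?A \<in> sets CT" by (simp only:) measurable
  have "circ -` ?A \<inter> space Tmeas \<in> sets Tmeas"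
    by (rule measurable_sets[OF measurable_circ_CT A])
  then have "circ -` ?A \<inter> {0..1} \<in> sets lebesgue"
    by (auto simp: sets_restrict_space_iff)
  \<comment> \<open>The exhaustion is made in the parameter interval, where Lebesgue sets are
    F-sigma sets up to a null set; the closed pieces are compact there, so their images on the
    circle are closed.\<close>
  then obtain C T where FT: "fsigma C" "T \<in> null_sets lebesgue" "C \<union> T = circ -` ?A \<inter> {0..1}"
    using lebesgue_set_almost_fsigma by metis
  from FT(1) obtain F :: "nat \<Rightarrow> real set" where F: "\<And>n. closed (F n)" "C = (\<Union>n. F n)"
    by (auto simp: fsigma.simps)
  have Fn: "AE t in Tmeas. t \<notin> F n" for n
  proof (cases "F n = {}")
    case False
    have sub: "F n \<subseteq> circ -` ?A \<inter> {0..1}" using FT(3) F(2) by blast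
    let ?B = "circ ` F n"
    have "compact (F n)"
      using F(1)[of n] sub bounded_subset[of "{0..1::real}" "F n"] by (simp add: compact_eq_bounded_closed)
    then have "closed ?B"
      by (intro compact_imp_closed compact_continuous_image continuous_intros)
    have Bm: "?B \<in> sets CT"
    proof (rule CT_setsI)
      have "closed (circ -` ?B \<inter> {0..1})"
        by (subst Int_commute, rule continuous_closed_preimage) (auto intro: continuous_intros \<open>closed ?B\<close>)
      then show "circ -` ?B \<inter> {0..1} \<in> sets Tmeas"
        by (auto simp: sets_restrict_space_iff)
    qed auto
    have i: "integrable CT (\<lambda>z. of_real (indicator ?B z) * h z)"
      using integrable_mult_indicator[OF Bm h(1)] by (simp add: scaleR_conv_of_real)
    have "(\<integral>z. of_real (indicator ?B z) * h z \<partial>CT) = 0"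
      by (rule integral_closed_zero[OF h \<open>closed ?B\<close>]) (use False in auto)
    then have "(\<integral>z. Re (of_real (indicator ?B z) * h z) \<partial>CT) = 0"
      by (subst integral_Re[OF i]) simp
    moreover have nonneg: "0 \<le> Re (of_real (indicator ?B z) * h z)" for z
      using sub by (auto simp: indicator_def split: if_splits)
    ultimately have "AE z in CT. Re (of_real (indicator ?B z) * h z) = 0"
      using integral_nonneg_eq_0_iff_AE[of CT "\<lambda>z. Re (of_real (indicator ?B z) * h z)"] integrable_Re[OF i]
      by auto
    then have "AE z in CT. z \<notin> ?B"
    proof eventually_elim
      case (elim z)
      have "Re (h z) > 0" if "z \<in> ?B" using sub that by auto
      with elim show ?case by (auto simp: indicator_def split: if_splits)
    qed
    then have "AE t in Tmeas. circ t \<notin> ?B"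
      using AE_T_iff[of "\<lambda>z. z \<notin> ?B"] by (simp add: AE_T_def)
    then show ?thesis by eventually_elim auto
  qed auto
  have "AE t in Tmeas. \<forall>n. t \<notin> F n" using Fn by (simp add: AE_all_countable)
  moreover have "AE t in Tmeas. t \<notin> T"
  proof (rule AE_I')
    show "T \<in> null_sets Tmeas" using FT(2,3) by (auto simp: null_sets_restrict_space)
  qed auto
  moreover have "AE t in Tmeas. t \<in> {0..1}" by (rule AE_I2) auto
  ultimately have "AE t in Tmeas. \<not> Re (h (circ t)) > 0"
  proof eventually_elim
    case (elim t)
    then have "t \<notin> C \<union> T" using F(2) by auto
    with FT(3) elim(3) show ?case by auto
  qed
  then have "AE z in CT. \<not> Re (h z) > 0"
    using AE_T_iff[of "\<lambda>z. \<not> Re (h z) > 0"] by (simp add: AE_T_def)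
  then show ?thesis by (auto simp: not_less)
qed

theorem fc_zero_imp_AE_zero:
  assumes h: "integrable CT h" "\<And>k. fc h k = 0"
  shows "AE z in CT. h z = 0"
proof -
  \<comment> \<open>The multipliers 1, -1, i and -i bound the real and the imaginary part from both
    sides.\<close>
  have "AE z in CT. Re (c * h z) \<le> 0" for c
    by (rule fc_zero_Re_nonpos) (use h in \<open>auto simp: fc_cmult\<close>)
  from this[of 1] this[of "-1"] this[of \<i>] this[of "-\<i>"] show ?thesis
    by eventually_elim (auto simp: complex_eq_iff)
qed

corollary fc_eq_imp_AE_eq:
  assumes "integrable CT f" "integrable CT g" "\<And>k. fc f k = fc g k"
  shows "AE z in CT. f z = g z"
proof -
  have "AE z in CT. f z - g z = 0"
    by (rule fc_zero_imp_AE_zero) (use assms in \<open>auto simp: fc_diff\<close>)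
  then show ?thesis by auto
qed

text \<open>The minimal solution \<open>u\<close> of \<open>fc u k = fc h k\<close> (\<open>k \<in> K\<close>), where \<open>K\<close> is the zero set of \<open>fc f\<close>,
  is orthogonal to the characters outside \<open>K\<close>, so it has the coefficients of \<open>h\<close>; hence \<open>h = u\<close> is orthogonal to \<open>f\<close>.\<close>

lemma disjoint_spectrum_orthogonal:
  assumes f: "L2 CT f" and h: "L2 CT h" and dis: "\<And>k. fc f k = 0 \<or> fc h k = 0"
  shows "(\<integral>z. f z * cnj (h z) \<partial>CT) = 0"
proof -
  define \<G> where "\<G> = {(\<lambda>j::nat. \<lambda>z::complex. z powi (- k), fc h k) | k. fc f k = 0}"
  have 1: "L2 CT (G j)" if "(G, c) \<in> \<G>" "j < 1" for G c j
    using that L2_powi by (auto simp: \<G>_def)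
  have 2: "(\<Sum>j<1. \<integral>x. h x * G j x \<partial>CT) = c" if "(G, c) \<in> \<G>" for G c
    using that by (auto simp: \<G>_def fc_def)
  have "\<exists>u. (\<forall>j<1. L2 CT (u j)) \<and>
    (\<forall>G c. (G, c) \<in> \<G> \<longrightarrow> (\<Sum>j<1. \<integral>x. u j x * G j x \<partial>CT) = c) \<and>
    (\<forall>v. (\<forall>j<1. L2 CT (v j)) \<and> (\<forall>G c. (G, c) \<in> \<G> \<longrightarrow> (\<Sum>j<1. \<integral>x. v j x * G j x \<partial>CT) = 0)
       \<longrightarrow> (\<Sum>j<1. \<integral>x. u j x * cnj (v j x) \<partial>CT) = 0)"
    by (rule affine_L2_minimal[of CT \<G> 1 "\<lambda>_. h", OF CT.finite_measure_axioms]) (assumption | rule 1 h 2)+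
  then obtain u where u: "\<forall>j<1. L2 CT (u j)"
    "\<forall>G c. (G, c) \<in> \<G> \<longrightarrow> (\<Sum>j<1. \<integral>x. u j x * G j x \<partial>CT) = c"
    "\<forall>v. (\<forall>j<1. L2 CT (v j)) \<and> (\<forall>G c. (G, c) \<in> \<G> \<longrightarrow> (\<Sum>j<1. \<integral>x. v j x * G j x \<partial>CT) = 0)
       \<longrightarrow> (\<Sum>j<1. \<integral>x. u j x * cnj (v j x) \<partial>CT) = 0"
    by blast
  define U where "U = u 0"
  have U: "L2 CT U" using u(1) by (simp add: U_def)
  have U2: "fc U k = fc h k" if "fc f k = 0" for k
    using u(2)[rule_format, of "\<lambda>j z. z powi (- k)" "fc h k"] that by (auto simp: \<G>_def fc_def U_def)
  have U3: "(\<integral>x. U x * cnj (v x) \<partial>CT) = 0" if "L2 CT v" "\<And>k. fc f k = 0 \<Longrightarrow> fc v k = 0" for v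
    using u(3)[rule_format, of "\<lambda>_. v"] that by (auto simp: \<G>_def fc_def U_def)
  have "fc U k = fc h k" for k
  proof (cases "fc f k = 0")
    case False
    then have "(\<integral>x. U x * cnj (x powi k) \<partial>CT) = 0"
      by (intro U3 L2_powi) (auto simp: fc_powi)
    moreover have "(\<integral>x. U x * cnj (x powi k) \<partial>CT) = fc U k"
      unfolding fc_def by (rule Bochner_Integration.integral_cong) (auto simp: cnj_powi_sphere simp del: complex_cnj_power_int)
    ultimately show ?thesis using dis[of k] False by simp
  qed (rule U2)
  then have eq: "AE z in CT. U z = h z"
    by (intro fc_eq_imp_AE_eq CT.L2_integrable U h)
  have "(\<integral>z. h z * cnj (f z) \<partial>CT) = (\<integral>z. U z * cnj (f z) \<partial>CT)"
    by (rule integral_cong_AE) (use eq U f h in \<open>auto simp: L2_def elim!: eventually_mono\<close>)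
  also have "\<dots> = 0" by (rule U3) (use f in auto)
  finally have "cnj (\<integral>z. h z * cnj (f z) \<partial>CT) = 0" by simp
  then show ?thesis
    by (subst (asm) Bochner_Integration.integral_cnj[symmetric]) (simp add: mult.commute)
qed

section \<open>Hardy classes\<close>

interpretation CT: complete_measure CT
proof
  fix A N assume A: "A \<subseteq> N" and N: "N \<in> null_sets CT"
  have "circ -` N \<inter> {0..1} \<in> null_sets Tmeas"
    using N CT_null_iff[of N] by (auto simp: null_sets_def)
  then have "circ -` N \<inter> {0..1} \<in> null_sets lebesgue"
    by (auto simp: null_sets_restrict_space)
  then have "circ -` A \<inter> {0..1} \<in> null_sets lebesgue"
    by (rule completion.complete2[rotated]) (use A in auto)
  then have "circ -` A \<inter> {0..1} \<in> null_sets Tmeas"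
    by (auto simp: null_sets_restrict_space)
  moreover have "A \<subseteq> sphere 0 1"
    using A sets.sets_into_space[of N CT] N by (auto simp: null_sets_def)
  ultimately show "A \<in> sets CT" by (intro CT_setsI) auto
qed

lemma CT_not_AE_False: "\<not> (AE z in CT. False)"
proof
  assume "AE z in CT. False"
  then have "emeasure CT (space CT) = 0" by (simp add: AE_iff_measurable[OF _ refl] del: space_CT)
  then show False using emeasure_space_CT by simp
qed

text \<open>Completeness of \<open>CT\<close> is used here: it makes the Hardy classes depend only
  on the almost-everywhere class, as is needed when a function is known only to agree almost
  everywhere with \<open>\<Theta> g\<close>.\<close>

lemma measurable_CT_cong_AE:
  assumes f: "f \<in> borel_measurable CT" and eq: "AE z in CT. f z = (g z :: complex)"
  shows "g \<in> borel_measurable CT"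
proof (rule measurableI)
  fix B :: "complex set" assume "B \<in> sets borel"
  then have "f -` B \<inter> space CT \<in> sets CT" by (rule measurable_sets[OF f])
  then show "g -` B \<inter> space CT \<in> sets CT"
    by (rule CT.in_sets_AE[rotated]) (use eq in \<open>auto elim!: eventually_mono\<close>)
qed auto

lemma L2_cong_AE:
  assumes f: "L2 CT f" and eq: "AE z in CT. f z = g z" shows "L2 CT g"
proof -
  have g: "g \<in> borel_measurable CT"
    by (rule measurable_CT_cong_AE[OF _ eq]) (use f in \<open>simp add: L2_def\<close>)
  show ?thesis
    by (rule L2_bound[OF g, of "\<lambda>z. (norm (f z))\<^sup>2"]) (use f eq in \<open>auto simp: L2_def elim!: eventually_mono\<close>)
qed

lemma Lp2_iff: "Lp 2 f \<longleftrightarrow> L2 CT f"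
proof -
  have "integrable Tmeas (\<lambda>t. (norm (f (circ t)))\<^sup>2) \<longleftrightarrow> integrable CT (\<lambda>z. (norm (f z))\<^sup>2)"
    if "f \<in> borel_measurable CT"
    by (subst integrable_CT) (use that in auto)
  then show ?thesis unfolding Lp_def L2_def meas_T_iff by auto
qed

lemma Hp2_iff: "Hp 2 f \<longleftrightarrow> L2 CT f \<and> (\<forall>k<0. fc f k = 0)"
  unfolding Hp_def Lp2_iff by (auto simp: fourier_coeff_eq_fc L2_def)

lemma Hp1_iff: "Hp 1 f \<longleftrightarrow> integrable CT f \<and> (\<forall>k<0. fc f k = 0)"
proof -
  have "integrable Tmeas (\<lambda>t. norm (f (circ t)) powr 1) \<longleftrightarrow> integrable CT f"
    if f: "f \<in> borel_measurable CT"
  proof -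
    have "integrable Tmeas (\<lambda>t. norm (f (circ t)) powr 1) \<longleftrightarrow> integrable Tmeas (\<lambda>t. norm (f (circ t)))"
      by simp
    also have "\<dots> \<longleftrightarrow> integrable Tmeas (\<lambda>t. f (circ t))"
      by (rule integrable_norm_iff) (use f in measurable)
    finally show ?thesis using integrable_CT[OF f] by simp
  qed
  then show ?thesis unfolding Hp_def Lp_def meas_T_iff by (auto simp: fourier_coeff_eq_fc)
qed

lemma Hinf_iff:
  "Hinf f \<longleftrightarrow> f \<in> borel_measurable CT \<and> (\<exists>C. AE z in CT. norm (f z) \<le> C) \<and> (\<forall>k<0. fc f k = 0)"
  unfolding Hinf_def Linf_def meas_T_iff AE_T_iff by (auto simp: fourier_coeff_eq_fc)

lemma Hinf_imp_Hp2: "Hinf f \<Longrightarrow> Hp 2 f"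
  unfolding Hinf_iff Hp2_iff using CT.L2_bounded by blast

lemma L2_mult_Hinf: "L2 CT f \<Longrightarrow> Hinf g \<Longrightarrow> L2 CT (\<lambda>z. f z * g z)"
  unfolding Hinf_iff using L2_mult_bounded by blast

lemma Hinf_iff_bounded: "Hinf f \<longleftrightarrow> Hp 2 f \<and> (\<exists>C. AE z in CT. norm (f z) \<le> C)"
  using Hinf_imp_Hp2 by (auto simp: Hinf_iff Hp2_iff L2_def)

lemma Hp2_cong_AE: "Hp 2 f \<Longrightarrow> AE z in CT. f z = g z \<Longrightarrow> Hp 2 g"
  unfolding Hp2_iff using L2_cong_AE fc_cong_AE L2_measurable by metis

lemma Hp2_add: "Hp 2 f \<Longrightarrow> Hp 2 g \<Longrightarrow> Hp 2 (\<lambda>z. f z + g z)"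
  unfolding Hp2_iff by (auto simp: fc_add CT.L2_integrable intro: L2_add)

lemma Hp2_cmult: "Hp 2 f \<Longrightarrow> Hp 2 (\<lambda>z. c * f z)"
  unfolding Hp2_iff by (auto simp: fc_cmult intro: L2_cmult)

lemma Hp2_zero: "Hp 2 (\<lambda>z. 0)"
  unfolding Hp2_iff by (auto simp: fc_def L2_zero)

text \<open>Conjugation reflects the spectrum: \<open>g\<close> has only positive frequencies,
  \<open>cnj g\<close> only negative ones, and those are disjoint from the spectrum of
  \<open>f\<close>. This replaces the convolution formula for the coefficients of a product.\<close>

lemma integral_mult_analytic_zero:
  assumes f: "Hp 2 f" and g: "L2 CT g" "\<And>k. k \<le> 0 \<Longrightarrow> fc g k = 0"
  shows "(\<integral>z. f z * g z \<partial>CT) = 0"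
proof -
  have "(\<integral>z. f z * cnj (cnj (g z)) \<partial>CT) = 0"
  proof (rule disjoint_spectrum_orthogonal)
    fix k show "fc f k = 0 \<or> fc (\<lambda>z. cnj (g z)) k = 0"
      using f g(2)[of "- k"] by (cases "k < 0") (auto simp: Hp2_iff fc_cnj)
  qed (use f g in \<open>auto simp: Hp2_iff intro: L2_cnj\<close>)
  then show ?thesis by simp
qed

lemma Hp2_mult_Hinf:
  assumes f: "Hp 2 f" and g: "Hinf g" shows "Hp 2 (\<lambda>z. f z * g z)"
  unfolding Hp2_iff
proof (intro conjI allI impI)
  show "L2 CT (\<lambda>z. f z * g z)"
    using f g by (auto simp: Hp2_iff intro: L2_mult_Hinf)
  fix k :: int assume k: "k < 0"
  have "(\<integral>z. f z * (g z * z powi (- k)) \<partial>CT) = 0"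
  proof (rule integral_mult_analytic_zero[OF f])
    show "L2 CT (\<lambda>z. g z * z powi - k)"
      using Hinf_imp_Hp2[OF g] by (auto simp: Hp2_iff intro!: L2_mult_powi)
    show "fc (\<lambda>z. g z * z powi - k) j = 0" if "j \<le> 0" for j
      using g k that by (simp add: fc_shift Hinf_iff)
  qed
  then show "fc (\<lambda>z. f z * g z) k = 0" by (simp add: fc_def mult.assoc)
qed

lemma Hinf_mult:
  assumes f: "Hinf f" and g: "Hinf g" shows "Hinf (\<lambda>z. f z * g z)"
proof -
  from f g obtain C D where "AE z in CT. norm (f z) \<le> C" "AE z in CT. norm (g z) \<le> D"
    by (auto simp: Hinf_iff)
  then have "AE z in CT. norm (f z * g z) \<le> C * D"
    by eventually_elim (auto simp: norm_mult intro!: mult_mono order_trans[OF norm_ge_zero])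
  then show ?thesis
    unfolding Hinf_iff_bounded using Hp2_mult_Hinf[OF Hinf_imp_Hp2[OF f] g] by blast
qed

lemma Hinf_add:
  assumes f: "Hinf f" and g: "Hinf g" shows "Hinf (\<lambda>z. f z + g z)"
proof -
  from f g obtain C D where "AE z in CT. norm (f z) \<le> C" "AE z in CT. norm (g z) \<le> D"
    by (auto simp: Hinf_iff)
  then have "AE z in CT. norm (f z + g z) \<le> C + D"
    by eventually_elim (auto intro!: norm_triangle_le add_mono)
  then show ?thesis
    unfolding Hinf_iff_bounded using Hp2_add[OF Hinf_imp_Hp2[OF f] Hinf_imp_Hp2[OF g]] by blast
qed

lemma Hinf_const: "Hinf (\<lambda>z. c)"
  using fc_powi[of 0] fc_cmult[of c "\<lambda>z. z powi 0"] by (auto simp: Hinf_iff)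

lemma Hinf_cmult: "Hinf f \<Longrightarrow> Hinf (\<lambda>z. c * f z)"
  by (rule Hinf_mult[OF Hinf_const])

lemma Hinf_uminus: "Hinf f \<Longrightarrow> Hinf (\<lambda>z. - f z)"
  using Hinf_cmult[of f "-1"] by simp

lemma Hinf_diff: "Hinf f \<Longrightarrow> Hinf g \<Longrightarrow> Hinf (\<lambda>z. f z - g z)"
  using Hinf_add[OF _ Hinf_uminus, of f g] by simp

lemma Hinf_sum: "(\<And>i. i \<in> I \<Longrightarrow> Hinf (f i)) \<Longrightarrow> Hinf (\<lambda>z. \<Sum>i\<in>I. f i z)"
  by (induction I rule: infinite_finite_induct) (auto simp: Hinf_const intro!: Hinf_add)

lemma Hinf_cong_AE: "Hinf f \<Longrightarrow> AE z in CT. f z = g z \<Longrightarrow> Hinf g"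
  unfolding Hinf_iff_bounded
proof (elim conjE exE, intro conjI)
  fix C assume *: "Hp 2 f" "AE z in CT. norm (f z) \<le> C" "AE z in CT. f z = g z"
  show "Hp 2 g" by (rule Hp2_cong_AE[OF *(1,3)])
  have "AE z in CT. norm (g z) \<le> C" using *(2,3) by eventually_elim auto
  then show "\<exists>C. AE z in CT. norm (g z) \<le> C" by blast
qed

section \<open>Shift-invariant subspaces and wandering vectors\<close>

text \<open>The pairing is bilinear because the rows of \<Phi> enter the kernel unconjugated; where
  a Hermitian product is meant, the second argument is conjugated explicitly.\<close>

definition ip :: "nat \<Rightarrow> (nat \<Rightarrow> complex \<Rightarrow> complex) \<Rightarrow> (nat \<Rightarrow> complex \<Rightarrow> complex) \<Rightarrow> complex \<Rightarrow> complex" where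
  "ip m f G z = (\<Sum>j<m. f j z * G j z)"

text \<open>All closed shift-invariant subspaces needed here are cut out of \<open>H\<^sup>2\<close> by linear conditions of two kinds:
  analyticity of \<open>ip m f G\<close> for \<open>G \<in> \<A>\<close>, and vanishing of \<open>ip m f G\<close> for \<open>G \<in> \<B>\<close>.\<close>

definition invsub :: "nat \<Rightarrow> (nat \<Rightarrow> complex \<Rightarrow> complex) set \<Rightarrow> (nat \<Rightarrow> complex \<Rightarrow> complex) set \<Rightarrow>
    (nat \<Rightarrow> complex \<Rightarrow> complex) set" where
  "invsub m \<A> \<B> = {f. (\<forall>j<m. Hp 2 (f j)) \<and> (\<forall>G\<in>\<A>. \<forall>k<0. fc (ip m f G) k = 0) \<and>
     (\<forall>G\<in>\<B>. AE z in CT. ip m f G z = 0)}"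

definition L2_vecs :: "nat \<Rightarrow> (nat \<Rightarrow> complex \<Rightarrow> complex) set \<Rightarrow> bool" where
  "L2_vecs m \<A> \<longleftrightarrow> (\<forall>G\<in>\<A>. \<forall>j<m. L2 CT (G j))"

lemma ip_integrable:
  assumes "\<And>j. j < m \<Longrightarrow> L2 CT (f j)" "\<And>j. j < m \<Longrightarrow> L2 CT (G j)"
  shows "integrable CT (ip m f G)"
  unfolding ip_def by (intro Bochner_Integration.integrable_sum L2_mult_integrable assms) auto

lemma fc_ip:
  assumes "\<And>j. j < m \<Longrightarrow> L2 CT (f j)" "\<And>j. j < m \<Longrightarrow> L2 CT (G j)"
  shows "(\<Sum>j<m. \<integral>z. f j z * (G j z * z powi (- k)) \<partial>CT) = fc (ip m f G) k"
proof -
  have "fc (ip m f G) k = (\<integral>z. (\<Sum>j<m. f j z * (G j z * z powi (- k))) \<partial>CT)"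
    by (simp add: fc_def ip_def sum_distrib_right mult.assoc)
  also have "\<dots> = (\<Sum>j<m. \<integral>z. f j z * (G j z * z powi (- k)) \<partial>CT)"
    by (rule Bochner_Integration.integral_sum) (use assms in \<open>auto intro!: L2_mult_integrable L2_mult_powi\<close>)
  finally show ?thesis by simp
qed

lemma ip_shift: "ip m (\<lambda>j z. f j z * z powi n) G = (\<lambda>z. ip m f G z * z powi n)"
  by (rule ext) (simp add: ip_def sum_distrib_left mult_ac)

lemma ip_add: "ip m (\<lambda>j z. f j z + g j z) G = (\<lambda>z. ip m f G z + ip m g G z)"
  by (auto simp: ip_def distrib_right sum.distrib)

lemma ip_cmult: "ip m (\<lambda>j z. c * f j z) G = (\<lambda>z. c * ip m f G z)"
  by (auto simp: ip_def sum_distrib_left mult_ac)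

lemma invsub_Hp2: "f \<in> invsub m \<A> \<B> \<Longrightarrow> j < m \<Longrightarrow> Hp 2 (f j)"
  by (simp add: invsub_def)

lemma invsub_L2: "f \<in> invsub m \<A> \<B> \<Longrightarrow> j < m \<Longrightarrow> L2 CT (f j)"
  by (simp add: invsub_def Hp2_iff)

lemma invsub_cmult: "f \<in> invsub m \<A> \<B> \<Longrightarrow> (\<lambda>j z. c * f j z) \<in> invsub m \<A> \<B>"
  by (auto simp: invsub_def ip_cmult fc_cmult Hp2_cmult elim!: eventually_mono)

lemma invsub_add:
  assumes "f \<in> invsub m \<A> \<B>" "g \<in> invsub m \<A> \<B>" "L2_vecs m \<A>"
  shows "(\<lambda>j z. f j z + g j z) \<in> invsub m \<A> \<B>"
proof -
  have "fc (ip m (\<lambda>j z. f j z + g j z) G) k = fc (ip m f G) k + fc (ip m g G) k" if "G \<in> \<A>" for G k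
    unfolding ip_add using assms that
    by (intro fc_add ip_integrable) (auto simp: L2_vecs_def intro: invsub_L2)
  moreover have "AE z in CT. ip m (\<lambda>j z. f j z + g j z) G z = 0" if "G \<in> \<B>" for G
  proof -
    have "AE z in CT. ip m f G z = 0" "AE z in CT. ip m g G z = 0"
      using assms that by (auto simp: invsub_def)
    then show ?thesis by eventually_elim (simp add: ip_add)
  qed
  ultimately show ?thesis using assms by (auto simp: invsub_def Hp2_add)
qed

lemma invsub_diff:
  assumes "f \<in> invsub m \<A> \<B>" "g \<in> invsub m \<A> \<B>" "L2_vecs m \<A>"
  shows "(\<lambda>j z. f j z - g j z) \<in> invsub m \<A> \<B>"
  using invsub_add[OF assms(1) invsub_cmult[OF assms(2), of "-1"] assms(3)] by simp

lemma invsub_shift: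
  assumes "f \<in> invsub m \<A> \<B>" "n \<ge> 0"
  shows "(\<lambda>j z. f j z * z powi n) \<in> invsub m \<A> \<B>"
  using assms by (auto simp: invsub_def ip_shift fc_shift Hp2_iff L2_mult_powi elim!: eventually_mono)

text \<open>Every condition defining the subspace, and the normalisation of the \<open>N\<close>-th
  coefficient of coordinate \<open>i\<close>, is a prescribed Fourier coefficient of some
  \<open>ip\<close>. The minimal-norm member meeting them is orthogonal to all members whose
  \<open>N\<close>-th coefficient in coordinate \<open>i\<close> is 0.\<close>

lemma invsub_minimal:
  assumes L2: "L2_vecs m \<A>" "L2_vecs m \<B>" and f: "f \<in> invsub m \<A> \<B>" and i: "i < m" "fc (f i) N = 1"
  shows "\<exists>w\<in>invsub m \<A> \<B>. fc (w i) N = 1 \<and>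
    (\<forall>v\<in>invsub m \<A> \<B>. fc (v i) N = 0 \<longrightarrow> fc (ip m w (\<lambda>j z. cnj (v j z))) 0 = 0)"
proof -
  define e where "e = (\<lambda>i j (z::complex). if j = (i::nat) then 1 else (0::complex))"
  have ip_e: "ip m u (e l) = u l" if "l < m" for u l
    using that by (auto simp: ip_def e_def if_distrib if_distribR sum.delta' cong: if_cong)
  \<comment> \<open>A triple \<open>(G, k, c)\<close> stands for the condition
    \<open>fc (ip m u G) k = c\<close>. The coordinate vectors \<open>e l\<close> express
    analyticity of the coordinates, and vanishing against \<open>\<B>\<close> is expressed by
    coefficients of all indices.\<close>
  define R where "R = {(e l, k, 0::complex) | l k. l < m \<and> k < (0::int)} \<union>
     {(G, k, 0) | G k. G \<in> \<A> \<and> k < 0} \<union> {(G, k, 0) | G k. G \<in> \<B>} \<union> {(e i, N, 1)}"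
  define \<G> where "\<G> = {(\<lambda>j z. G j z * z powi (- k), c) | G k c. (G, k, c) \<in> R}"
  have L2e: "L2 CT (e l j)" for l j by (auto simp: e_def CT.L2_const L2_zero)
  have RL2: "L2 CT (G j)" if "(G, k, c) \<in> R" "j < m" for G k c j
    using that L2 L2e by (auto simp: R_def L2_vecs_def)
  have R_iff: "(\<forall>G k c. (G, k, c) \<in> R \<longrightarrow> fc (ip m u G) k = c) \<longleftrightarrow> u \<in> invsub m \<A> \<B> \<and> fc (u i) N = 1"
    if u: "\<forall>j<m. L2 CT (u j)" for u
  proof -
    have "(\<forall>k. fc (ip m u G) k = 0) \<longleftrightarrow> (AE z in CT. ip m u G z = 0)" if "G \<in> \<B>" for G
    proof -
      have int: "integrable CT (ip m u G)"
        using u that L2(2) by (intro ip_integrable) (auto simp: L2_vecs_def)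
      show ?thesis
      proof
        assume "AE z in CT. ip m u G z = 0"
        then show "\<forall>k. fc (ip m u G) k = 0"
          using fc_cong_AE[of "ip m u G" "\<lambda>z. 0"] int by (simp add: fc_def)
      qed (use fc_zero_imp_AE_zero[OF int] in blast)
    qed
    moreover have "(\<forall>G k c. (G, k, c) \<in> R \<longrightarrow> fc (ip m u G) k = c) \<longleftrightarrow>
      (\<forall>l<m. \<forall>k<0. fc (u l) k = 0) \<and> (\<forall>G\<in>\<A>. \<forall>k<0. fc (ip m u G) k = 0) \<and>
      (\<forall>G\<in>\<B>. \<forall>k. fc (ip m u G) k = 0) \<and> fc (u i) N = 1"
      (is "?L \<longleftrightarrow> ?R")
    proof
      assume L: ?L
      have "fc (u l) k = 0" if "l < m" "k < 0" for l k
        using L[rule_format, of "e l" k 0] that ip_e by (auto simp: R_def)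
      moreover have "fc (u i) N = 1"
        using L[rule_format, of "e i" N 1] i ip_e by (auto simp: R_def)
      moreover have "fc (ip m u G) k = 0" if "G \<in> \<A> \<and> k < 0 \<or> G \<in> \<B>" for G k
        using L[rule_format, of G k 0] that by (auto simp: R_def)
      ultimately show ?R by blast
    next
      assume ?R
      then show ?L unfolding R_def using i ip_e by auto
    qed
    ultimately show ?thesis using u by (auto simp: invsub_def Hp2_iff)
  qed
  have R0: "(\<forall>G k c. (G, k, c) \<in> R \<longrightarrow> fc (ip m v G) k = 0)"
    if v: "v \<in> invsub m \<A> \<B>" "fc (v i) N = 0" for v
  proof -
    have "fc (ip m v G) k = 0" if "G \<in> \<B>" for G k
    proof -
      have int: "integrable CT (ip m v G)"
        using v that L2(2) by (intro ip_integrable) (auto simp: L2_vecs_def intro: invsub_L2)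
      show ?thesis
        using fc_cong_AE[of "ip m v G" "\<lambda>z. 0"] int v that by (simp add: fc_def invsub_def)
    qed
    then show ?thesis using v i
      unfolding R_def by (auto simp: ip_e invsub_def Hp2_iff)
  qed
  \<comment> \<open>The parameter \<open>h\<close> serves both the prescribed values (the identity)
    and the homogeneous conditions (constantly 0).\<close>
  have conv: "(\<forall>G c. (G, c) \<in> \<G> \<longrightarrow> (\<Sum>j<m. \<integral>z. u j z * G j z \<partial>CT) = h c) \<longleftrightarrow>
      (\<forall>G k c. (G, k, c) \<in> R \<longrightarrow> fc (ip m u G) k = h c)" if u: "\<forall>j<m. L2 CT (u j)" for u h
  proof -
    have "(\<forall>G c. (G, c) \<in> \<G> \<longrightarrow> (\<Sum>j<m. \<integral>z. u j z * G j z \<partial>CT) = h c) \<longleftrightarrow>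
      (\<forall>G k c. (G, k, c) \<in> R \<longrightarrow> (\<Sum>j<m. \<integral>z. u j z * (G j z * z powi (- k)) \<partial>CT) = h c)"
      unfolding \<G>_def by blast
    also have "\<dots> \<longleftrightarrow> (\<forall>G k c. (G, k, c) \<in> R \<longrightarrow> fc (ip m u G) k = h c)"
    proof -
      have "(\<Sum>j<m. \<integral>z. u j z * (G j z * z powi (- k)) \<partial>CT) = fc (ip m u G) k" if "(G, k, c) \<in> R" for G k c
        by (rule fc_ip) (use u RL2[OF that] in auto)
      then show ?thesis by auto
    qed
    finally show ?thesis .
  qed
  have fL2: "\<forall>j<m. L2 CT (f j)" using f by (auto intro: invsub_L2)
  have "\<exists>u. (\<forall>j<m. L2 CT (u j)) \<and>
    (\<forall>G c. (G, c) \<in> \<G> \<longrightarrow> (\<Sum>j<m. \<integral>x. u j x * G j x \<partial>CT) = c) \<and>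
    (\<forall>v. (\<forall>j<m. L2 CT (v j)) \<and> (\<forall>G c. (G, c) \<in> \<G> \<longrightarrow> (\<Sum>j<m. \<integral>x. v j x * G j x \<partial>CT) = 0)
       \<longrightarrow> (\<Sum>j<m. \<integral>x. u j x * cnj (v j x) \<partial>CT) = 0)"
  proof (rule affine_L2_minimal[OF CT.finite_measure_axioms])
    show "L2 CT (G j)" if "(G, c) \<in> \<G>" "j < m" for G c j
      using that by (auto simp: \<G>_def intro!: L2_mult_powi RL2)
    show "L2 CT (f j)" if "j < m" for j using fL2 that by simp
    show "(\<Sum>j<m. \<integral>x. f j x * G j x \<partial>CT) = c" if "(G, c) \<in> \<G>" for G c
      using conv[OF fL2, of "\<lambda>c. c"] R_iff[OF fL2] f i that by blast
  qed
  then obtain w where w: "\<forall>j<m. L2 CT (w j)"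
    "\<forall>G c. (G, c) \<in> \<G> \<longrightarrow> (\<Sum>j<m. \<integral>x. w j x * G j x \<partial>CT) = c"
    "\<forall>v. (\<forall>j<m. L2 CT (v j)) \<and> (\<forall>G c. (G, c) \<in> \<G> \<longrightarrow> (\<Sum>j<m. \<integral>x. v j x * G j x \<partial>CT) = 0)
       \<longrightarrow> (\<Sum>j<m. \<integral>x. w j x * cnj (v j x) \<partial>CT) = 0"
    by blast
  have win: "w \<in> invsub m \<A> \<B> \<and> fc (w i) N = 1"
    using conv[OF w(1), of "\<lambda>c. c"] R_iff[OF w(1)] w(2) by blast
  show ?thesis
  proof (intro bexI[of _ w] conjI ballI impI)
    fix v assume v: "v \<in> invsub m \<A> \<B>" "fc (v i) N = 0"
    have vL2: "\<forall>j<m. L2 CT (v j)" using v by (auto intro: invsub_L2)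
    have "(\<Sum>j<m. \<integral>x. w j x * cnj (v j x) \<partial>CT) = 0"
      using w(3) vL2 conv[OF vL2, of "\<lambda>c. 0"] R0[OF v] by blast
    then show "fc (ip m w (\<lambda>j z. cnj (v j z))) 0 = 0"
      using fc_ip[of m w "\<lambda>j z. cnj (v j z)" 0] w(1) vL2 by (simp add: L2_cnj)
  qed (use win in auto)
qed

text \<open>The coefficient of index \<open>k\<close> is the L^2 inner product of \<open>w\<close>
  with the k-th shift of \<open>f\<close>.\<close>

definition wandering :: "nat \<Rightarrow> (nat \<Rightarrow> complex \<Rightarrow> complex) set \<Rightarrow> (nat \<Rightarrow> complex \<Rightarrow> complex) \<Rightarrow> bool" where
  "wandering m S w \<longleftrightarrow> w \<in> S \<and> (\<forall>f\<in>S. \<forall>k>0. fc (ip m w (\<lambda>j z. cnj (f j z))) k = 0)"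

text \<open>If \<open>w\<close> and \<open>w'\<close> are wandering then all Fourier coefficients of \<open>ip m w (cnj w')\<close> vanish, except the one of index 0.\<close>

lemma wandering_ip_const:
  assumes w: "wandering m (invsub m \<A> \<B>) w" and w': "wandering m (invsub m \<A> \<B>) w'"
  defines "u \<equiv> ip m w (\<lambda>j z. cnj (w' j z))"
  shows "AE z in CT. u z = fc u 0"
proof (rule fc_eq_imp_AE_eq)
  show "integrable CT u"
    unfolding u_def using w w' by (intro ip_integrable L2_cnj) (auto simp: wandering_def intro: invsub_L2)
  fix k :: int
  have c: "fc (\<lambda>z. fc u 0) k = (if k = 0 then fc u 0 else 0)"
    using fc_cmult[of "fc u 0" "\<lambda>z. z powi 0" k] fc_powi[of 0 k] by auto
  have sym: "u = (\<lambda>z. cnj (ip m w' (\<lambda>j z. cnj (w j z)) z))"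
    by (auto simp: u_def ip_def mult.commute)
  show "fc u k = fc (\<lambda>z. fc u 0) k"
  proof (cases k "0::int" rule: linorder_cases)
    case less
    then show ?thesis unfolding c
      by (subst sym) (use w w' in \<open>auto simp: fc_cnj wandering_def\<close>)
  next
    case greater
    then have "fc u k = 0" using w w' by (simp add: u_def wandering_def)
    with greater show ?thesis by (simp add: c)
  next
    case equal
    then show ?thesis unfolding c by simp
  qed
qed auto

text \<open>Let \<open>N\<close> be the lowest index at which a coordinate of some member has a
  nonzero coefficient, and minimise the norm among members whose coefficient there is 1. A proper
  shift of a member has coefficient 0 at \<open>N\<close>, by the choice of \<open>N\<close>, hence
  is orthogonal to the minimal vector.\<close>

lemma wandering_exists:
  assumes L2: "L2_vecs m \<A>" "L2_vecs m \<B>" and f: "f \<in> invsub m \<A> \<B>"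
    and nz: "j < m" "\<not> (AE z in CT. f j z = 0)"
  shows "\<exists>w. wandering m (invsub m \<A> \<B>) w \<and> (AE z in CT. ip m w (\<lambda>j z. cnj (w j z)) z = 1)"
proof -
  let ?S = "invsub m \<A> \<B>"
  define P where "P n \<longleftrightarrow> (\<exists>f\<in>?S. \<exists>i<m. fc (f i) (int n) \<noteq> 0)" for n
  have "\<exists>k. fc (f j) k \<noteq> 0"
    using fc_zero_imp_AE_zero[OF CT.L2_integrable[OF invsub_L2[OF f nz(1)]]] nz(2) by blast
  then obtain k where k: "fc (f j) k \<noteq> 0" by blast
  then have "k \<ge> 0" using invsub_Hp2[OF f nz(1)] by (force simp: Hp2_iff)
  then have "P (nat k)" using f nz(1) k by (auto simp: P_def)
  define N where "N = (LEAST n. P n)"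
  have "P N" unfolding N_def by (rule LeastI) fact
  then obtain g i where g: "g \<in> ?S" "i < m" "fc (g i) (int N) \<noteq> 0" by (auto simp: P_def)
  define h where "h = (\<lambda>j z. (1 / fc (g i) (int N)) * g j z)"
  have h: "h \<in> ?S" "fc (h i) (int N) = 1"
    unfolding h_def using g by (auto intro: invsub_cmult simp only: fc_cmult) auto
  obtain w where w: "w \<in> ?S" "fc (w i) (int N) = 1"
      "\<And>v. v \<in> ?S \<Longrightarrow> fc (v i) (int N) = 0 \<Longrightarrow> fc (ip m w (\<lambda>j z. cnj (v j z))) 0 = 0"
    using invsub_minimal[OF L2 h(1) g(2) h(2)] by blast
  have wand: "fc (ip m w (\<lambda>j z. cnj (v j z))) k = 0" if v: "v \<in> ?S" "k > 0" for v k
  proof -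
    have "fc (v i) (int N - k) = 0"
    proof (cases "int N - k < 0")
      case True
      then show ?thesis using invsub_Hp2[OF v(1) g(2)] by (simp add: Hp2_iff)
    next
      case False
      then have "nat (int N - k) < N" using v(2) by linarith
      then have "\<not> P (nat (int N - k))" unfolding N_def by (rule not_less_Least)
      then show ?thesis using v g(2) False by (auto simp: P_def)
    qed
    then have "fc (ip m w (\<lambda>j z. cnj (v j z * z powi k))) 0 = 0"
      by (intro w(3) invsub_shift) (use v in \<open>auto simp: fc_shift\<close>)
    also have "fc (ip m w (\<lambda>j z. cnj (v j z * z powi k))) 0 = fc (ip m w (\<lambda>j z. cnj (v j z))) k"
      unfolding fc_def
      by (rule Bochner_Integration.integral_cong)
        (auto simp: ip_def cnj_powi_sphere sum_distrib_right mult.assoc simp del: complex_cnj_power_int)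
    finally show ?thesis .
  qed
  have ww: "wandering m ?S w" using w wand by (auto simp: wandering_def)
  define u where "u = ip m w (\<lambda>j z. cnj (w j z))"
  have u: "AE z in CT. u z = fc u 0" unfolding u_def by (rule wandering_ip_const[OF ww ww])
  have u_eq: "u z = of_real (\<Sum>j<m. (norm (w j z))\<^sup>2)" for z
    unfolding u_def ip_def by (simp only: of_real_sum complex_norm_square)
  have "fc u 0 \<noteq> 0"
  proof
    assume u0: "fc u 0 = 0"
    from u have "AE z in CT. w i z = 0"
    proof (eventually_elim)
      case (elim z)
      then have "(\<Sum>j<m. (norm (w j z))\<^sup>2) = 0" using u_eq[of z] u0 by (simp only: of_real_eq_0_iff)
      then have "\<forall>j\<in>{..<m}. (norm (w j z))\<^sup>2 = 0" by (subst (asm) sum_nonneg_eq_0_iff) auto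
      then show ?case using g(2) by simp
    qed
    then have "fc (w i) (int N) = 0"
      using fc_cong_AE[of "w i" "\<lambda>z. 0"] invsub_L2[OF w(1) g(2)] by (simp add: fc_def L2_def)
    with w(2) show False by simp
  qed
  \<comment> \<open>The function \<open>u\<close> is pointwise a sum of squares, so one point at
    which it takes its almost-everywhere value shows that the constant is real and
    nonnegative.\<close>
  obtain z0 where z0: "u z0 = fc u 0"
    using u CT_not_AE_False by (metis (mono_tags, lifting) eventually_mono)
  define c where "c = (\<Sum>j<m. (norm (w j z0))\<^sup>2)"
  have c1: "fc u 0 = of_real c"
    using z0 u_eq[of z0] by (simp only: c_def)
  moreover have "c \<ge> 0" unfolding c_def by (intro sum_nonneg) auto
  ultimately have c: "fc u 0 = of_real c" "c > 0"
    using \<open>fc u 0 \<noteq> 0\<close> by (auto simp: less_le)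
  define v where "v = (\<lambda>j z. of_real (1 / sqrt c) * w j z)"
  have "wandering m ?S v"
    unfolding wandering_def
  proof (intro conjI ballI allI impI)
    show "v \<in> ?S" unfolding v_def by (rule invsub_cmult[OF w(1)])
    fix f k assume "f \<in> ?S" "(k::int) > 0"
    then show "fc (ip m v (\<lambda>j z. cnj (f j z))) k = 0"
      unfolding v_def ip_cmult fc_cmult by (simp add: wand)
  qed
  moreover have "AE z in CT. ip m v (\<lambda>j z. cnj (v j z)) z = 1"
    using u
  proof eventually_elim
    case (elim z)
    have "ip m v (\<lambda>j z. cnj (v j z)) z = of_real (1 / sqrt c) * of_real (1 / sqrt c) * u z"
      unfolding v_def u_def ip_def by (simp add: sum_distrib_left mult_ac)
    also have "\<dots> = of_real (1 / sqrt c * (1 / sqrt c) * c)"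
      using elim c(1) by (simp only: of_real_mult)
    also have "1 / sqrt c * (1 / sqrt c) * c = 1" using c(2) by (simp add: field_simps)
    finally show ?case by simp
  qed
  ultimately show ?thesis by blast
qed

lemma AE_all_less: "(\<And>l. l < k \<Longrightarrow> AE z in M. P l z) \<Longrightarrow> AE z in M. \<forall>l<k::nat. P l z"
  by (subst AE_all_countable) auto

lemma Hinf_unit_vector:
  assumes w: "Hp 2 (w j)" and unit: "AE z in CT. ip m w (\<lambda>j z. cnj (w j z)) z = 1" and j: "j < m"
  shows "Hinf (w j)"
proof -
  have "AE z in CT. norm (w j z) \<le> 1"
    using unit
  proof eventually_elim
    case (elim z)
    then have "complex_of_real (\<Sum>j<m. (norm (w j z))\<^sup>2) = 1"
      unfolding ip_def of_real_sum complex_norm_square .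
    then have "(\<Sum>j<m. (norm (w j z))\<^sup>2) = 1" by (simp only: of_real_eq_1_iff)
    moreover have "(norm (w j z))\<^sup>2 \<le> (\<Sum>j<m. (norm (w j z))\<^sup>2)"
      by (rule member_le_sum) (use j in auto)
    ultimately show ?case by (simp add: abs_square_le_1)
  qed
  with w show ?thesis by (auto simp: Hinf_iff_bounded)
qed

text \<open>A unit wandering vector of that subspace vanishes on the zero set of \<open>f\<close>
  and yet has norm 1 almost everywhere, so the zero set is null.\<close>

theorem Hp2_AE_nonzero:
  assumes f: "Hp 2 f" and nz: "\<not> (AE z in CT. f z = 0)"
  shows "AE z in CT. f z \<noteq> 0"
proof -
  let ?E = "{z \<in> sphere 0 1. f z = 0}"
  define G where "G = (\<lambda>(j::nat) z. complex_of_real (indicator ?E z))"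
  have [measurable]: "f \<in> borel_measurable CT" using f by (simp add: Hp2_iff L2_def)
  have "?E = {z \<in> space CT. f z = 0}" by simp
  then have E: "?E \<in> sets CT" by (simp only:) measurable
  have "L2 CT (\<lambda>z. complex_of_real (indicator ?E z))"
  proof (rule CT.L2_bounded[where C=1])
    show "(\<lambda>z. complex_of_real (indicator ?E z)) \<in> borel_measurable CT" using E by measurable
  qed (auto simp: indicator_def)
  then have L2: "L2_vecs 1 {}" "L2_vecs 1 {G}" by (auto simp: L2_vecs_def G_def)
  have "(\<lambda>_. f) \<in> invsub 1 {} {G}"
    using f by (auto simp: invsub_def ip_def G_def indicator_def)
  from wandering_exists[OF L2 this zero_less_one nz]
  obtain w where "wandering 1 (invsub 1 {} {G}) w" "AE z in CT. ip 1 w (\<lambda>j z. cnj (w j z)) z = 1"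
    by blast
  then have "AE z in CT. ip 1 w (\<lambda>j z. cnj (w j z)) z = 1" "AE z in CT. ip 1 w G z = 0"
    by (auto simp: wandering_def invsub_def)
  with AE_space show ?thesis
    by eventually_elim (auto simp: ip_def G_def indicator_def split: if_splits)
qed

lemma Hinf_AE_nonzero: "Hinf f \<Longrightarrow> \<not> (AE z in CT. f z = 0) \<Longrightarrow> AE z in CT. f z \<noteq> 0"
  by (rule Hp2_AE_nonzero[OF Hinf_imp_Hp2])

text \<open>The graph of multiplication by \<open>f\<close> is a shift-invariant subspace of \<open>H\<^sup>2 \<times> H\<^sup>2\<close>, and it contains \<open>(1, f)\<close>;
  a unit wandering vector of the graph represents \<open>f\<close> as a quotient of two functions in \<open>H\<^sup>\<infinity>\<close>.\<close>

lemma Nev_Hp2: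
  assumes f: "Hp 2 f" shows "Nev f"
proof -
  define G where "G = (\<lambda>(j::nat) z. if j = 0 then f z else - 1)"
  define F where "F = (\<lambda>(j::nat) z. if j = 0 then 1 else f z)"
  have "L2 CT (G j)" for j
    using f CT.L2_const by (cases "j = 0") (auto simp: G_def Hp2_iff)
  then have L2: "L2_vecs 2 {}" "L2_vecs 2 {G}" by (auto simp: L2_vecs_def)
  have F: "F \<in> invsub 2 {} {G}"
  proof -
    have "Hp 2 (F j)" for j
      using f Hinf_imp_Hp2[OF Hinf_const[of 1]] by (cases "j = 0") (auto simp: F_def)
    then show ?thesis by (auto simp: invsub_def ip_def F_def G_def numeral_2_eq_2)
  qed
  have "\<not> (AE z in CT. F 0 z = 0)" using CT_not_AE_False by (simp add: F_def)
  from wandering_exists[OF L2 F _ this]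
  obtain w where w: "wandering 2 (invsub 2 {} {G}) w" and unit: "AE z in CT. ip 2 w (\<lambda>j z. cnj (w j z)) z = 1"
    by auto
  have wS: "w \<in> invsub 2 {} {G}" using w by (simp add: wandering_def)
  have Hw: "Hinf (w 0)" "Hinf (w 1)"
    by (rule Hinf_unit_vector[OF invsub_Hp2[OF wS] unit]; simp)+
  have eq: "AE z in CT. ip 2 w G z = 0" using wS by (auto simp: invsub_def)
  \<comment> \<open>The graph relation is \<open>w 0 * f = w 1\<close>; if \<open>w 0\<close>
    vanished, so would \<open>w 1\<close>, against the unit norm.\<close>
  have "\<not> (AE z in CT. w 0 z = 0)"
  proof
    assume "AE z in CT. w 0 z = 0"
    with eq unit have "AE z in CT. False"
      by eventually_elim (auto simp: ip_def G_def numeral_2_eq_2)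
    with CT_not_AE_False show False by blast
  qed
  moreover from Hinf_AE_nonzero[OF Hw(1) this] eq
  have "AE z in CT. f z = w 1 z / w 0 z"
    by eventually_elim (auto simp: ip_def G_def numeral_2_eq_2 field_simps)
  ultimately show ?thesis using Hw unfolding Nev_def AE_T_iff by blast
qed

section \<open>Homogeneous linear systems over \<open>H\<^sup>\<infinity>\<close>\<close>

text \<open>Gaussian elimination without division, by induction on the number of equations. A pivot
  that is not almost everywhere zero is nonzero almost everywhere, so scaling by it keeps a solution
  nontrivial.\<close>

lemma Hinf_underdetermined:
  assumes "finite I" "finite J" "card I < card J" "\<And>i j. i \<in> I \<Longrightarrow> j \<in> J \<Longrightarrow> Hinf (A i j)"
  shows "\<exists>c. (\<forall>j\<in>J. Hinf (c j)) \<and> (\<exists>j\<in>J. \<not> (AE z in CT. c j z = 0)) \<and>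
    (\<forall>i\<in>I. AE z in CT. (\<Sum>j\<in>J. A i j z * c j z) = 0)"
  using assms
proof (induction I arbitrary: J A rule: finite_induct)
  case empty
  then show ?case
    using CT_not_AE_False by (intro exI[of _ "\<lambda>_ _. 1"]) (auto simp: Hinf_const)
next
  case (insert r I)
  show ?case
  proof (cases "\<forall>j\<in>J. AE z in CT. A r j z = 0")
    case True
    have "\<exists>c. (\<forall>j\<in>J. Hinf (c j)) \<and> (\<exists>j\<in>J. \<not> (AE z in CT. c j z = 0)) \<and>
        (\<forall>i\<in>I. AE z in CT. (\<Sum>j\<in>J. A i j z * c j z) = 0)"
      by (rule insert.IH) (use insert.prems insert.hyps in auto)
    then obtain c where c: "\<forall>j\<in>J. Hinf (c j)" "\<exists>j\<in>J. \<not> (AE z in CT. c j z = 0)"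
        "\<forall>i\<in>I. AE z in CT. (\<Sum>j\<in>J. A i j z * c j z) = 0" by blast
    have "AE z in CT. \<forall>j\<in>J. A r j z = 0" using True insert.prems(1) by (simp add: AE_finite_all)
    then have "AE z in CT. (\<Sum>j\<in>J. A r j z * c j z) = 0" by eventually_elim simp
    with c show ?thesis by auto
  next
    case False
    then obtain s where s: "s \<in> J" "\<not> (AE z in CT. A r s z = 0)" by blast
    define J' where "J' = J - {s}"
    have J': "finite J'" "s \<notin> J'" "J = insert s J'" using insert.prems(1) s(1) by (auto simp: J'_def)
    \<comment> \<open>The 2 x 2 minors with the pivot \<open>A r s\<close>: the system left after
      eliminating unknown \<open>s\<close>.\<close>
    define B where "B i j z = A r s z * A i j z - A i s z * A r j z" for i j z
    have "\<exists>c. (\<forall>j\<in>J'. Hinf (c j)) \<and> (\<exists>j\<in>J'. \<not> (AE z in CT. c j z = 0)) \<and>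
        (\<forall>i\<in>I. AE z in CT. (\<Sum>j\<in>J'. B i j z * c j z) = 0)"
    proof (rule insert.IH)
      show "Hinf (B i j)" if "i \<in> I" "j \<in> J'" for i j
        unfolding B_def[abs_def] using that J' by (intro Hinf_diff Hinf_mult insert.prems) auto
    qed (use insert.prems insert.hyps J' in auto)
    then obtain c where c: "\<forall>j\<in>J'. Hinf (c j)" "\<exists>j\<in>J'. \<not> (AE z in CT. c j z = 0)"
        "\<forall>i\<in>I. AE z in CT. (\<Sum>j\<in>J'. B i j z * c j z) = 0" by blast
    \<comment> \<open>Back substitution, multiplied through by the pivot; the entry at
      \<open>s\<close> is the one that makes equation \<open>r\<close> hold.\<close>
    define d where "d j z = (if j = s then - (\<Sum>j\<in>J'. A r j z * c j z) else A r s z * c j z)" for j z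
    have sum_d: "(\<Sum>j\<in>J. A i j z * d j z) = (\<Sum>j\<in>J'. B i j z * c j z)" for i z
    proof -
      have "(\<Sum>j\<in>J. A i j z * d j z) = A i s z * d s z + (\<Sum>j\<in>J'. A i j z * d j z)"
        using J' by simp
      also have "(\<Sum>j\<in>J'. A i j z * d j z) = (\<Sum>j\<in>J'. A r s z * A i j z * c j z)"
        using J' by (intro sum.cong) (auto simp: d_def mult_ac)
      finally show ?thesis
        by (simp add: d_def B_def left_diff_distrib sum_subtractf sum_distrib_left mult.assoc)
    qed
    have "Hinf (d j)" if "j \<in> J" for j
    proof (cases "j = s")
      case True
      then have "d j = (\<lambda>z. - (\<Sum>j\<in>J'. A r j z * c j z))" by (simp add: d_def fun_eq_iff)
      then show ?thesis using c J' insert.prems(3) by (auto intro!: Hinf_uminus Hinf_sum Hinf_mult)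
    next
      case False
      then have "d j = (\<lambda>z. A r s z * c j z)" by (simp add: d_def fun_eq_iff)
      then show ?thesis using c J' insert.prems(3) that False by (auto intro!: Hinf_mult)
    qed
    moreover have "\<exists>j\<in>J. \<not> (AE z in CT. d j z = 0)"
    proof -
      from c(2) obtain j where j: "j \<in> J'" "\<not> (AE z in CT. c j z = 0)" by blast
      have "\<not> (AE z in CT. d j z = 0)"
      proof
        assume "AE z in CT. d j z = 0"
        with Hinf_AE_nonzero[OF insert.prems(3) s(2)] s(1) j(1) J'(2) have "AE z in CT. c j z = 0"
          by (auto simp: d_def elim: eventually_elim2)
        with j show False by blast
      qed
      with j J' show ?thesis by blast
    qed
    moreover have "AE z in CT. (\<Sum>j\<in>J. A i j z * d j z) = 0" if "i \<in> insert r I" for i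
    proof (cases "i = r")
      case True
      then show ?thesis unfolding sum_d by (simp add: B_def mult.commute)
    next
      case False
      with c that show ?thesis unfolding sum_d by auto
    qed
    ultimately show ?thesis by blast
  qed
qed

section \<open>The Beurling--Lax--Halmos theorem\<close>

lemma inner_matrix_AE:
  "inner_matrix m k \<Theta> \<Longrightarrow>
    AE z in CT. \<forall>p<k. \<forall>q<k. (\<Sum>i<m. cnj (\<Theta> i p z) * \<Theta> i q z) = (if p = q then 1 else 0)"
  by (simp add: inner_matrix_def AE_T_iff)

text \<open>Coefficients are recovered by applying the adjoint, since the columns are orthonormal.
  Injectivity, the projection identity and the boundedness of coefficients all rest on this.\<close>

lemma isometry_left_inverse:
  fixes A :: "nat \<Rightarrow> nat \<Rightarrow> complex"
  assumes "\<forall>p<k. \<forall>q<k. (\<Sum>i<m. cnj (A i p) * A i q) = (if p = q then 1 else 0)" "p < k"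
  shows "(\<Sum>i<m. (\<Sum>q<k. A i q * c q) * cnj (A i p)) = c p"
proof -
  have "(\<Sum>i<m. (\<Sum>q<k. A i q * c q) * cnj (A i p)) = (\<Sum>i<m. \<Sum>q<k. cnj (A i p) * A i q * c q)"
    by (simp add: sum_distrib_left mult_ac)
  also have "\<dots> = (\<Sum>q<k. (\<Sum>i<m. cnj (A i p) * A i q) * c q)"
    by (subst sum.swap) (simp add: sum_distrib_right)
  also have "\<dots> = (\<Sum>q<k. if q = p then c q else 0)"
    using assms by (intro sum.cong) auto
  also have "\<dots> = c p" using assms(2) by simp
  finally show ?thesis .
qed

lemma inner_matrix_injective:
  assumes \<Theta>: "inner_matrix m k \<Theta>" and z: "\<And>i. i < m \<Longrightarrow> AE z in CT. (\<Sum>l<k. \<Theta> i l z * c l z) = 0"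
    and p: "p < k"
  shows "AE z in CT. c p z = 0"
proof -
  have "AE z in CT. \<forall>i<m. (\<Sum>l<k. \<Theta> i l z * c l z) = 0" by (rule AE_all_less) (rule z)
  with inner_matrix_AE[OF \<Theta>] show ?thesis
  proof eventually_elim
    case (elim z)
    show ?case
      using isometry_left_inverse[OF elim(1) p, of "\<lambda>q. c q z"] elim(2) by simp
  qed
qed

text \<open>More columns than rows would admit a nontrivial bounded analytic combination of the
  columns equal to 0. The bound is what guarantees a longest wandering frame.\<close>

lemma inner_matrix_le:
  assumes \<Theta>: "inner_matrix m k \<Theta>" shows "k \<le> m"
proof (rule ccontr)
  assume "\<not> k \<le> m"
  then have "\<exists>c. (\<forall>j\<in>{..<k}. Hinf (c j)) \<and> (\<exists>j\<in>{..<k}. \<not> (AE z in CT. c j z = 0)) \<and>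
    (\<forall>i\<in>{..<m}. AE z in CT. (\<Sum>j\<in>{..<k}. \<Theta> i j z * c j z) = 0)"
    using \<Theta> by (intro Hinf_underdetermined) (auto simp: inner_matrix_def)
  with inner_matrix_injective[OF \<Theta>] show False by blast
qed

section \<open>Closure properties of invariant subspaces and the spanning frame\<close>

lemma invsub_cong_AE:
  assumes f: "f \<in> invsub m \<A> \<B>" and eq: "\<And>j. j < m \<Longrightarrow> AE z in CT. f j z = g j z"
    and \<A>: "L2_vecs m \<A>"
  shows "g \<in> invsub m \<A> \<B>"
proof -
  have g: "Hp 2 (g j)" if "j < m" for j
    by (rule Hp2_cong_AE[OF invsub_Hp2[OF f that] eq[OF that]])
  have ip: "AE z in CT. ip m f G z = ip m g G z" for G
  proof -
    have "AE z in CT. \<forall>j<m. f j z = g j z" by (rule AE_all_less) (rule eq)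
    then show ?thesis by eventually_elim (simp add: ip_def)
  qed
  have "fc (ip m g G) k = 0" if "G \<in> \<A>" "k < 0" for G k
  proof -
    have "fc (ip m f G) k = fc (ip m g G) k"
      using \<A> that f g by (intro fc_cong_AE ip borel_measurable_integrable ip_integrable)
        (auto simp: L2_vecs_def Hp2_iff intro: invsub_L2)
    with f that show ?thesis by (simp add: invsub_def)
  qed
  moreover have "AE z in CT. ip m g G z = 0" if "G \<in> \<B>" for G
  proof -
    have "AE z in CT. ip m f G z = 0" using f that by (simp add: invsub_def)
    with ip[of G] show ?thesis by eventually_elim simp
  qed
  ultimately show ?thesis using g by (simp add: invsub_def)
qed

lemma invsub_sum:
  assumes "\<And>l. l \<in> I \<Longrightarrow> f l \<in> invsub m \<A> \<B>" "L2_vecs m \<A>"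
  shows "(\<lambda>j z. \<Sum>l\<in>I. f l j z) \<in> invsub m \<A> \<B>"
proof -
  have "(\<lambda>j z. 0) \<in> invsub m \<A> \<B>"
    by (auto simp: invsub_def ip_def Hp2_zero fc_def)
  then show ?thesis using assms(1)
    by (induction I rule: infinite_finite_induct) (auto intro!: invsub_add assms(2))
qed

text \<open>Boundedness of \<open>f\<close> keeps \<open>ip m f G\<close> in L^2, so its product
  with an unbounded \<open>g\<close> in H^2 is still covered by the orthogonality of disjoint
  spectra.\<close>

lemma invsub_mult:
  assumes f: "f \<in> invsub m \<A> \<B>" "\<And>j. j < m \<Longrightarrow> Hinf (f j)" and g: "Hp 2 g" and \<A>: "L2_vecs m \<A>"
  shows "(\<lambda>j z. f j z * g z) \<in> invsub m \<A> \<B>"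
proof -
  have ip: "ip m (\<lambda>j z. f j z * g z) G = (\<lambda>z. g z * ip m f G z)" for G
    by (rule ext) (simp add: ip_def sum_distrib_left mult_ac)
  have "fc (ip m (\<lambda>j z. f j z * g z) G) k = 0" if "G \<in> \<A>" "k < 0" for G k
  proof -
    have "L2 CT (\<lambda>z. f j z * G j z)" if j: "j < m" for j
      using L2_mult_Hinf[OF _ f(2)[OF j], of "G j"] \<A> \<open>G \<in> \<A>\<close> j by (simp add: L2_vecs_def mult.commute)
    then have L2: "L2 CT (ip m f G)"
      unfolding ip_def[abs_def] by (intro L2_sum) auto
    have "(\<integral>z. g z * (ip m f G z * z powi (- k)) \<partial>CT) = 0"
    proof (rule integral_mult_analytic_zero[OF g L2_mult_powi[OF L2]])
      show "fc (\<lambda>z. ip m f G z * z powi - k) j = 0" if "j \<le> 0" for j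
        using f(1) \<open>k < 0\<close> \<open>G \<in> \<A>\<close> that by (simp add: fc_shift invsub_def)
    qed
    then show ?thesis by (simp add: ip fc_def mult.assoc)
  qed
  moreover have "AE z in CT. ip m (\<lambda>j z. f j z * g z) G z = 0" if "G \<in> \<B>" for G
  proof -
    have "AE z in CT. ip m f G z = 0" using f(1) that by (simp add: invsub_def)
    then show ?thesis by eventually_elim (simp add: ip)
  qed
  moreover have "Hp 2 (\<lambda>z. f j z * g z)" if "j < m" for j
    using Hp2_mult_Hinf[OF g f(2)[OF that]] by (simp add: mult.commute)
  ultimately show ?thesis by (simp add: invsub_def)
qed

definition wandering_frame where
  "wandering_frame m S k \<Theta> \<longleftrightarrow> (\<forall>l<k. wandering m S (\<lambda>j. \<Theta> j l)) \<and> inner_matrix m k \<Theta>"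

text \<open>A wandering frame with the largest number of columns spans: otherwise the vectors of \<open>S\<close> orthogonal to
  all of its shifts form a nonzero invariant subspace, whose wandering vectors extend the frame.\<close>

theorem beurling_lax_halmos:
  assumes L2: "L2_vecs m \<A>" "L2_vecs m \<B>"
  shows "\<exists>k \<Theta>. inner_matrix m k \<Theta> \<and> (\<forall>f. f \<in> invsub m \<A> \<B> \<longleftrightarrow>
    (\<exists>g. (\<forall>l<k. Hp 2 (g l)) \<and> (\<forall>j<m. AE z in CT. f j z = (\<Sum>l<k. \<Theta> j l z * g l z))))"
proof -
  define S where "S = invsub m \<A> \<B>"
  have "\<exists>\<Theta>. wandering_frame m S 0 \<Theta>"
    by (auto simp: wandering_frame_def inner_matrix_def AE_T_iff)
  moreover have "\<forall>k. (\<exists>\<Theta>. wandering_frame m S k \<Theta>) \<longrightarrow> k \<le> m"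
    using inner_matrix_le by (auto simp: wandering_frame_def)
  ultimately obtain k where k: "\<exists>\<Theta>. wandering_frame m S k \<Theta>"
      and max: "\<And>k'. (\<exists>\<Theta>. wandering_frame m S k' \<Theta>) \<Longrightarrow> k' \<le> k"
    using Nat.ex_has_greatest_nat[of "\<lambda>k. \<exists>\<Theta>. wandering_frame m S k \<Theta>" 0 m] by blast
  then obtain \<Theta> where wand: "\<And>l. l < k \<Longrightarrow> wandering m S (\<lambda>j. \<Theta> j l)" and inner: "inner_matrix m k \<Theta>"
    by (auto simp: wandering_frame_def)
  have Hinf: "Hinf (\<Theta> j l)" if "j < m" "l < k" for j l
    using inner that by (simp add: inner_matrix_def)
  have \<Theta>S: "(\<lambda>j. \<Theta> j l) \<in> S" if "l < k" for l using wand[OF that] by (simp add: wandering_def)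
  define \<Theta>c where "\<Theta>c l = (\<lambda>j z. cnj (\<Theta> j l z))" for l
  have \<Theta>c_L2: "L2 CT (\<Theta>c l j)" if "l < k" "j < m" for l j
    unfolding \<Theta>c_def using Hinf_imp_Hp2[OF Hinf[OF that(2,1)]] by (auto simp: Hp2_iff intro: L2_cnj)
  \<comment> \<open>The negative coefficients of this function are conjugates of the positive ones
    in the wandering condition, so wandering means exactly analyticity of the coefficients.\<close>
  have coeff: "Hp 2 (ip m f (\<Theta>c l))" if f: "f \<in> S" and l: "l < k" for f l
    unfolding Hp2_iff
  proof (intro conjI allI impI)
    have "L2 CT (\<lambda>z. f j z * \<Theta>c l j z)" if j: "j < m" for j
    proof -
      from Hinf[OF j l] obtain C where "\<Theta> j l \<in> borel_measurable CT" "AE z in CT. norm (\<Theta> j l z) \<le> C"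
        by (auto simp: Hinf_iff)
      then show ?thesis unfolding \<Theta>c_def
        using f j by (intro L2_mult_bounded[where C=C]) (auto simp: S_def intro: invsub_L2 measurable_cnj)
    qed
    then show "L2 CT (ip m f (\<Theta>c l))"
      unfolding ip_def[abs_def] by (intro L2_sum) auto
    fix n :: int assume n: "n < 0"
    have "ip m f (\<Theta>c l) = (\<lambda>z. cnj (ip m (\<lambda>j. \<Theta> j l) (\<lambda>j z. cnj (f j z)) z))"
      by (rule ext) (simp add: ip_def \<Theta>c_def mult.commute)
    then show "fc (ip m f (\<Theta>c l)) n = 0"
      using wand[OF l] f n by (simp add: fc_cnj wandering_def)
  qed
  have range: "(\<lambda>j z. \<Sum>l<k. \<Theta> j l z * g l z) \<in> S" if "\<And>l. l < k \<Longrightarrow> Hp 2 (g l)" for g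
    unfolding S_def
  proof (rule invsub_sum[OF _ L2(1)])
    fix l assume "l \<in> {..<k}"
    then show "(\<lambda>j z. \<Theta> j l z * g l z) \<in> invsub m \<A> \<B>"
      using \<Theta>S Hinf that L2(1) by (intro invsub_mult) (auto simp: S_def)
  qed
  \<comment> \<open>The pointwise orthogonal projection onto the span of the columns, that is
    \<Theta> times its adjoint applied to \<open>f\<close>.\<close>
  define proj where "proj f = (\<lambda>j z. \<Sum>l<k. \<Theta> j l z * ip m f (\<Theta>c l) z)" for f
  have projS: "proj f \<in> S" if "f \<in> S" for f
    unfolding proj_def by (rule range) (rule coeff[OF that])
  have ip_proj: "AE z in CT. \<forall>p<k. ip m (proj f) (\<Theta>c p) z = ip m f (\<Theta>c p) z" for f
    using inner_matrix_AE[OF inner]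
  proof eventually_elim
    case (elim z)
    show ?case
      using isometry_left_inverse[OF elim, of _ "\<lambda>l. ip m f (\<Theta>c l) z"]
      unfolding proj_def ip_def[of m "\<lambda>j z. \<Sum>l<k. \<Theta> j l z * ip m f (\<Theta>c l) z"]
      by (simp add: \<Theta>c_def)
  qed
  define S' where "S' = invsub m \<A> (\<B> \<union> \<Theta>c ` {..<k})"
  have L2': "L2_vecs m (\<B> \<union> \<Theta>c ` {..<k})" using L2(2) \<Theta>c_L2 by (auto simp: L2_vecs_def)
  have S'_iff: "f \<in> S' \<longleftrightarrow> f \<in> S \<and> (\<forall>l<k. AE z in CT. ip m f (\<Theta>c l) z = 0)" for f
    by (auto simp: S'_def S_def invsub_def)
  have res: "(\<lambda>j z. f j z - proj f j z) \<in> S'" if f: "f \<in> S" for f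
    unfolding S'_iff
  proof (intro conjI allI impI)
    show "(\<lambda>j z. f j z - proj f j z) \<in> S"
      using f projS[OF f] L2(1) unfolding S_def by (rule invsub_diff)
    fix l assume l: "l < k"
    from ip_proj[of f] show "AE z in CT. ip m (\<lambda>j z. f j z - proj f j z) (\<Theta>c l) z = 0"
      by eventually_elim (use l in \<open>simp add: ip_def left_diff_distrib sum_subtractf\<close>)
  qed
  have S'_zero: "AE z in CT. f j z = 0" if f: "f \<in> S'" and j: "j < m" for f j
  proof (rule ccontr)
    assume "\<not> (AE z in CT. f j z = 0)"
    from wandering_exists[OF L2(1) L2' f[unfolded S'_def] j this, folded S'_def]
    obtain w where w: "wandering m S' w" and unit: "AE z in CT. ip m w (\<lambda>j z. cnj (w j z)) z = 1" by blast
    have wS': "w \<in> S'" using w by (simp add: wandering_def)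
    then have wS: "w \<in> S" and w0: "\<And>l. l < k \<Longrightarrow> AE z in CT. ip m w (\<Theta>c l) z = 0"
      by (auto simp: S'_iff)
    have w0': "AE z in CT. \<forall>l<k. ip m w (\<Theta>c l) z = 0" by (rule AE_all_less[OF w0])
    have wL2: "L2 CT (w j)" if "j < m" for j using wS that by (auto simp: S_def intro: invsub_L2)
    \<comment> \<open>Pointwise, \<open>w\<close> is orthogonal to \<open>proj f\<close>; only the
      residual \<open>f - proj f\<close> contributes, and it lies in \<open>S'\<close>, where
      \<open>w\<close> is wandering.\<close>
    have wandS: "wandering m S w"
      unfolding wandering_def
    proof (intro conjI ballI allI impI)
      fix f and n :: int assume f: "f \<in> S" and n: "n > 0"
      let ?r = "\<lambda>j z. f j z - proj f j z"
      have fL2: "L2 CT (f j)" "L2 CT (?r j)" if "j < m" for j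
        using f res[OF f] that by (auto simp: S_def S'_def intro: invsub_L2)
      have "AE z in CT. ip m w (\<lambda>j z. cnj (f j z)) z = ip m w (\<lambda>j z. cnj (?r j z)) z"
        using w0'
      proof eventually_elim
        case (elim z)
        have "(\<Sum>j<m. w j z * cnj (proj f j z)) = (\<Sum>j<m. \<Sum>l<k. w j z * \<Theta>c l j z * cnj (ip m f (\<Theta>c l) z))"
          by (simp add: proj_def \<Theta>c_def sum_distrib_left mult.assoc)
        also have "\<dots> = (\<Sum>l<k. ip m w (\<Theta>c l) z * cnj (ip m f (\<Theta>c l) z))"
          by (subst sum.swap) (simp add: ip_def[of m w] sum_distrib_right)
        also have "\<dots> = 0" using elim by simp
        finally show ?case by (simp add: ip_def right_diff_distrib sum_subtractf)
      qed
      then have "fc (ip m w (\<lambda>j z. cnj (f j z))) n = fc (ip m w (\<lambda>j z. cnj (?r j z))) n"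
        using wL2 fL2
        by (intro fc_cong_AE borel_measurable_integrable ip_integrable) (auto intro: L2_cnj simp del: complex_cnj_diff)
      also have "\<dots> = 0" by (rule w[unfolded wandering_def, THEN conjunct2, rule_format, OF res[OF f] n])
      finally show "fc (ip m w (\<lambda>j z. cnj (f j z))) n = 0" .
    qed (rule wS)
    define \<Theta>' where "\<Theta>' j l = (if l = k then w j else \<Theta> j l)" for j l
    have "wandering_frame m S (Suc k) \<Theta>'"
      unfolding wandering_frame_def inner_matrix_def AE_T_iff
    proof (intro conjI allI impI)
      fix l assume "l < Suc k"
      then show "wandering m S (\<lambda>j. \<Theta>' j l)"
        using wandS wand by (cases "l = k") (auto simp: \<Theta>'_def)
    next
      fix i l assume il: "i < m" "l < Suc k"
      have "Hinf (w i)"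
        by (rule Hinf_unit_vector[OF _ unit il(1)]) (use wS il in \<open>auto simp: S_def intro: invsub_Hp2\<close>)
      then show "Hinf (\<Theta>' i l)" using il Hinf by (auto simp: \<Theta>'_def)
    next
      show "AE z in CT. \<forall>p<Suc k. \<forall>q<Suc k. (\<Sum>i<m. cnj (\<Theta>' i p z) * \<Theta>' i q z) = (if p = q then 1 else 0)"
        using inner_matrix_AE[OF inner] w0' unit
      proof eventually_elim
        case (elim z)
        have a: "(\<Sum>i<m. cnj (\<Theta> i p z) * w i z) = 0" if "p < k" for p
          using elim(2) that by (simp add: ip_def \<Theta>c_def mult.commute)
        have b: "(\<Sum>i<m. cnj (w i z) * \<Theta> i p z) = 0" if "p < k" for p
        proof -
          have "(\<Sum>i<m. cnj (w i z) * \<Theta> i p z) = cnj (\<Sum>i<m. cnj (\<Theta> i p z) * w i z)"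
            by (simp add: mult.commute)
          with a[OF that] show ?thesis by simp
        qed
        have c: "(\<Sum>i<m. cnj (w i z) * w i z) = 1"
          using elim(3) by (simp add: ip_def mult.commute)
        show ?case
          using elim(1) a b c by (auto simp: \<Theta>'_def less_Suc_eq)
      qed
    qed
    then have "Suc k \<le> k" by (intro max exI)
    then show False by simp
  qed
  have "f \<in> S \<longleftrightarrow> (\<exists>g. (\<forall>l<k. Hp 2 (g l)) \<and> (\<forall>j<m. AE z in CT. f j z = (\<Sum>l<k. \<Theta> j l z * g l z)))" for f
  proof
    assume f: "f \<in> S"
    have "AE z in CT. f j z = (\<Sum>l<k. \<Theta> j l z * ip m f (\<Theta>c l) z)" if "j < m" for j
      using S'_zero[OF res[OF f] that] by eventually_elim (simp add: proj_def)
    with coeff[OF f] show "\<exists>g. (\<forall>l<k. Hp 2 (g l)) \<and> (\<forall>j<m. AE z in CT. f j z = (\<Sum>l<k. \<Theta> j l z * g l z))"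
      by (intro exI[of _ "\<lambda>l. ip m f (\<Theta>c l)"]) auto
  next
    assume "\<exists>g. (\<forall>l<k. Hp 2 (g l)) \<and> (\<forall>j<m. AE z in CT. f j z = (\<Sum>l<k. \<Theta> j l z * g l z))"
    then obtain g where g: "\<And>l. l < k \<Longrightarrow> Hp 2 (g l)"
        "\<And>j. j < m \<Longrightarrow> AE z in CT. f j z = (\<Sum>l<k. \<Theta> j l z * g l z)" by blast
    have "(\<lambda>j z. \<Sum>l<k. \<Theta> j l z * g l z) \<in> invsub m \<A> \<B>"
      using range[of g] g(1) by (simp add: S_def)
    moreover have "AE z in CT. (\<Sum>l<k. \<Theta> j l z * g l z) = f j z" if "j < m" for j
      using g(2)[OF that] by eventually_elim simp
    ultimately show "f \<in> S"
      unfolding S_def by (rule invsub_cong_AE[OF _ _ L2(1)])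
  qed
  with inner show ?thesis unfolding S_def by blast
qed

section \<open>Rank of an inner matrix and the Nevanlinna index\<close>

text \<open>A minimal set \<open>T\<close> of rows on which \<open>\<Theta>\<close> is still injective has exactly \<open>k\<close> elements: dropping a row \<open>t\<close>
  produces a vector \<open>c t\<close> that only row \<open>t\<close> detects, and more than \<open>k\<close> such vectors would be dependent.\<close>

lemma inner_matrix_row_basis:
  assumes \<Theta>: "inner_matrix m k \<Theta>"
  shows "\<exists>T\<subseteq>{..<m}. card T = k \<and>
    (\<forall>c. (\<forall>l<k. Hinf (c l)) \<and> (\<forall>i\<in>T. AE z in CT. (\<Sum>l<k. \<Theta> i l z * c l z) = 0) \<longrightarrow>
      (\<forall>l<k. AE z in CT. c l z = 0))"
proof -
  define good where "good T \<longleftrightarrow> (\<forall>c. (\<forall>l<k. Hinf (c l)) \<longrightarrow> (\<forall>i\<in>T. AE z in CT. (\<Sum>l<k. \<Theta> i l z * c l z) = 0) \<longrightarrow>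
     (\<forall>l<k. AE z in CT. c l z = 0))" for T
  have H: "Hinf (\<Theta> i l)" if "i < m" "l < k" for i l using \<Theta> that by (simp add: inner_matrix_def)
  have "good {..<m}"
    unfolding good_def using inner_matrix_injective[OF \<Theta>] by auto
  then obtain T where T: "T \<subseteq> {..<m}" "good T"
      and min: "\<And>T'. T' \<subseteq> {..<m} \<Longrightarrow> good T' \<Longrightarrow> card T \<le> card T'"
    using ex_has_least_nat[of "\<lambda>T. T \<subseteq> {..<m} \<and> good T" "{..<m}" card] by blast
  have finT: "finite T" using T(1) finite_subset by blast
  have "k \<le> card T"
  proof (rule ccontr)
    assume "\<not> k \<le> card T"
    then have "\<exists>c. (\<forall>j\<in>{..<k}. Hinf (c j)) \<and> (\<exists>j\<in>{..<k}. \<not> (AE z in CT. c j z = 0)) \<and>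
        (\<forall>i\<in>T. AE z in CT. (\<Sum>j\<in>{..<k}. \<Theta> i j z * c j z) = 0)"
      using T(1) H finT by (intro Hinf_underdetermined) auto
    with T(2) show False unfolding good_def by blast
  qed
  moreover have "card T \<le> k"
  proof (rule ccontr)
    assume lt: "\<not> card T \<le> k"
    have "\<forall>t\<in>T. \<exists>c. (\<forall>l<k. Hinf (c l)) \<and> (\<forall>i\<in>T - {t}. AE z in CT. (\<Sum>l<k. \<Theta> i l z * c l z) = 0) \<and>
        (\<exists>l<k. \<not> (AE z in CT. c l z = 0))"
    proof
      fix t assume "t \<in> T"
      then have "\<not> good (T - {t})"
        using min[of "T - {t}"] T(1) card_Diff1_less[OF finT] by (metis Diff_subset not_less subset_trans)
      then show "\<exists>c. (\<forall>l<k. Hinf (c l)) \<and> (\<forall>i\<in>T - {t}. AE z in CT. (\<Sum>l<k. \<Theta> i l z * c l z) = 0) \<and>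
        (\<exists>l<k. \<not> (AE z in CT. c l z = 0))"
        unfolding good_def by blast
    qed
    from bchoice[OF this] obtain c where
      c: "\<And>t l. t \<in> T \<Longrightarrow> l < k \<Longrightarrow> Hinf (c t l)"
         "\<And>t i. t \<in> T \<Longrightarrow> i \<in> T - {t} \<Longrightarrow> AE z in CT. (\<Sum>l<k. \<Theta> i l z * c t l z) = 0"
         "\<And>t. t \<in> T \<Longrightarrow> \<exists>l<k. \<not> (AE z in CT. c t l z = 0)"
      by blast
    have "\<exists>d. (\<forall>t\<in>T. Hinf (d t)) \<and> (\<exists>t\<in>T. \<not> (AE z in CT. d t z = 0)) \<and>
        (\<forall>l\<in>{..<k}. AE z in CT. (\<Sum>t\<in>T. c t l z * d t z) = 0)"
      by (rule Hinf_underdetermined) (use lt finT c(1) in auto)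
    then obtain d s where d: "\<And>t. t \<in> T \<Longrightarrow> Hinf (d t)" "s \<in> T" "\<not> (AE z in CT. d s z = 0)"
        "\<And>l. l < k \<Longrightarrow> AE z in CT. (\<Sum>t\<in>T. c t l z * d t z) = 0"
      by auto
    have "AE z in CT. \<forall>l<k. (\<Sum>t\<in>T. c t l z * d t z) = 0"
      by (rule AE_all_less) (rule d(4))
    moreover have "AE z in CT. \<forall>t\<in>T - {s}. (\<Sum>l<k. \<Theta> s l z * c t l z) = 0"
      using c(2) d(2) finT by (subst AE_finite_all) auto
    moreover have "AE z in CT. d s z \<noteq> 0" by (rule Hinf_AE_nonzero[OF d(1)[OF d(2)] d(3)])
    \<comment> \<open>In row \<open>s\<close> of the dependence all terms with \<open>t\<close>
      other than \<open>s\<close> drop out, and \<open>d s\<close> can be cancelled. Thus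
      \<open>c s\<close> is annihilated by every row in \<open>T\<close> and must be zero.\<close>
    ultimately have row: "AE z in CT. (\<Sum>l<k. \<Theta> s l z * c s l z) = 0"
    proof eventually_elim
      case (elim z)
      have "0 = (\<Sum>l<k. \<Theta> s l z * (\<Sum>t\<in>T. c t l z * d t z))"
        using elim(1) by simp
      also have "\<dots> = (\<Sum>t\<in>T. (\<Sum>l<k. \<Theta> s l z * c t l z) * d t z)"
        by (simp add: sum_distrib_left sum_distrib_right mult.assoc) (rule sum.swap)
      also have "\<dots> = (\<Sum>l<k. \<Theta> s l z * c s l z) * d s z"
        using elim(2) by (subst sum.remove[OF finT d(2)]) auto
      finally show ?case using elim(3) by simp
    qed
    have "AE z in CT. (\<Sum>l<k. \<Theta> i l z * c s l z) = 0" if "i \<in> T" for i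
      using row c(2)[OF d(2)] that by (cases "i = s") auto
    then have "\<forall>l<k. AE z in CT. c s l z = 0"
      using T(2) c(1)[OF d(2)] unfolding good_def by blast
    with c(3)[OF d(2)] show False by blast
  qed
  ultimately have "card T = k" by simp
  with T show ?thesis unfolding good_def by blast
qed

section \<open>Clearing denominators and computing the index\<close>

lemma Nev_denominator:
  assumes "Nev f" obtains h where "Hinf h" "AE z in CT. h z \<noteq> 0" "Hinf (\<lambda>z. h z * f z)"
proof -
  from assms obtain g h where gh: "Hinf g" "Hinf h" "\<not> (AE z in CT. h z = 0)" "AE z in CT. f z = g z / h z"
    unfolding Nev_def AE_T_iff by blast
  have nz: "AE z in CT. h z \<noteq> 0" by (rule Hinf_AE_nonzero[OF gh(2,3)])
  with gh(4) have "AE z in CT. g z = h z * f z" by eventually_elim simp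
  with gh(1) have "Hinf (\<lambda>z. h z * f z)" by (rule Hinf_cong_AE)
  with gh(2) nz show ?thesis by (rule that)
qed

lemma Nev_common_denominator:
  assumes "finite I" "\<And>i. i \<in> I \<Longrightarrow> Nev (f i)"
  shows "\<exists>h. Hinf h \<and> (AE z in CT. h z \<noteq> 0) \<and> (\<forall>i\<in>I. Hinf (\<lambda>z. h z * f i z))"
  using assms
proof (induction I rule: finite_induct)
  case empty
  show ?case by (intro exI[of _ "\<lambda>_. 1"]) (simp add: Hinf_const)
next
  case (insert i I)
  then obtain h where h: "Hinf h" "AE z in CT. h z \<noteq> 0" "\<And>i. i \<in> I \<Longrightarrow> Hinf (\<lambda>z. h z * f i z)"
    by auto
  obtain g where g: "Hinf g" "AE z in CT. g z \<noteq> 0" "Hinf (\<lambda>z. g z * f i z)"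
    using Nev_denominator[OF insert.prems[of i]] by auto
  show ?case
  proof (intro exI[of _ "\<lambda>z. g z * h z"] conjI ballI)
    show "AE z in CT. g z * h z \<noteq> 0" using h(2) g(2) by eventually_elim simp
    fix j assume "j \<in> insert i I"
    then show "Hinf (\<lambda>z. g z * h z * f j z)"
      using Hinf_mult[OF h(1) g(3)] Hinf_mult[OF g(1) h(3)[of j]] by (auto simp: mult_ac)
  qed (rule Hinf_mult[OF g(1) h(1)])
qed

text \<open>Products of two L^2 functions are integrable, so the H^1 condition on \<Phi> f amounts
  to the vanishing of negative coefficients, which is the kind of condition that \<open>\<A>\<close>
  encodes.\<close>

lemma kerHankel_eq_invsub:
  assumes "\<forall>i<n. \<forall>j<m. Lp 2 (\<Phi> i j)"
  shows "kerHankel n m \<Phi> = invsub m (\<Phi> ` {..<n}) {}"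
proof -
  have ip: "(\<lambda>z. \<Sum>j<m. \<Phi> i j z * f j z) = ip m f (\<Phi> i)" for i f
    by (rule ext) (simp add: ip_def mult.commute)
  have "integrable CT (ip m f (\<Phi> i))" if "\<forall>j<m. Hp 2 (f j)" "i < n" for f i
    using assms that by (intro ip_integrable) (auto simp: Lp2_iff Hp2_iff)
  then show ?thesis unfolding kerHankel_def invsub_def ip Hp1_iff by auto
qed

text \<open>Pointwise, \<open>g\<close> is the adjoint of \<open>\<Theta>\<close> applied to
  \<open>F\<close>, and both are bounded. This makes \<open>g\<close> admissible for the row basis,
  whose injectivity concerns H-infinity coefficients.\<close>

lemma inner_coefficients_Hinf:
  assumes \<Theta>: "inner_matrix m k \<Theta>" and F: "\<And>j. j < m \<Longrightarrow> Hinf (F j)" and g: "Hp 2 (g p)" "p < k"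
    and eq: "\<And>j. j < m \<Longrightarrow> AE z in CT. F j z = (\<Sum>l<k. \<Theta> j l z * g l z)"
  shows "Hinf (g p)"
proof -
  have "\<exists>C. AE z in CT. norm (F j z * cnj (\<Theta> j p z)) \<le> C" if j: "j < m" for j
  proof -
    have "Hinf (\<lambda>z. F j z * \<Theta> j p z)"
      using \<Theta> F g(2) j by (intro Hinf_mult) (auto simp: inner_matrix_def)
    then show ?thesis by (auto simp: Hinf_iff norm_mult)
  qed
  then obtain C where C: "\<And>j. j < m \<Longrightarrow> AE z in CT. norm (F j z * cnj (\<Theta> j p z)) \<le> C j" by metis
  have "AE z in CT. \<forall>j<m. norm (F j z * cnj (\<Theta> j p z)) \<le> C j" by (rule AE_all_less) (rule C)
  moreover have "AE z in CT. \<forall>j<m. F j z = (\<Sum>l<k. \<Theta> j l z * g l z)" by (rule AE_all_less) (rule eq)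
  ultimately have "AE z in CT. norm (g p z) \<le> (\<Sum>j<m. C j)"
    using inner_matrix_AE[OF \<Theta>]
  proof eventually_elim
    case (elim z)
    have "g p z = (\<Sum>j<m. F j z * cnj (\<Theta> j p z))"
      using isometry_left_inverse[OF elim(3) g(2), of "\<lambda>l. g l z"] elim(2) by simp
    also have "norm \<dots> \<le> (\<Sum>j<m. C j)"
      using elim(1) by (intro sum_norm_le) auto
    finally show ?case .
  qed
  with g show ?thesis by (auto simp: Hinf_iff_bounded)
qed

lemma ind_Nev_eq:
  assumes cols: "\<forall>i<n. \<forall>j<m. Lp 2 (\<Phi> i j)" and \<Theta>: "inner_matrix m k \<Theta>"
    and ker: "\<And>f. f \<in> kerHankel n m \<Phi> \<longleftrightarrow>
      (\<exists>g. (\<forall>l<k. Hp 2 (g l)) \<and> (\<forall>j<m. AE z in CT. f j z = (\<Sum>l<k. \<Theta> j l z * g l z)))"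
  shows "ind_Nev n m \<Phi> = m - k"
  unfolding ind_Nev_def
proof (rule cSup_eq_maximum)
  have H: "Hinf (\<Theta> i l)" if "i < m" "l < k" for i l using \<Theta> that by (simp add: inner_matrix_def)
  fix d assume "d \<in> {card S | S. S \<subseteq> {..<m} \<and> indep_Nev n \<Phi> S}"
  then obtain S where S: "d = card S" "S \<subseteq> {..<m}" "indep_Nev n \<Phi> S" by blast
  show "d \<le> m - k"
  proof (rule ccontr)
    assume "\<not> d \<le> m - k"
    moreover have finS: "finite S" using S(2) finite_subset by blast
    \<comment> \<open>Fewer than \<open>k\<close> rows lie outside \<open>S\<close>, so some
      nontrivial bounded combination of the columns of \<Theta> vanishes on all of them.\<close>
    ultimately have "card ({..<m} - S) < card {..<k}"
      using S inner_matrix_le[OF \<Theta>] card_mono[OF _ S(2)] by (simp add: card_Diff_subset)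
    then have "\<exists>c. (\<forall>j\<in>{..<k}. Hinf (c j)) \<and> (\<exists>j\<in>{..<k}. \<not> (AE z in CT. c j z = 0)) \<and>
        (\<forall>i\<in>{..<m} - S. AE z in CT. (\<Sum>j\<in>{..<k}. \<Theta> i j z * c j z) = 0)"
      using H by (intro Hinf_underdetermined) auto
    then obtain c p where c: "\<And>l. l < k \<Longrightarrow> Hinf (c l)" "p < k" "\<not> (AE z in CT. c p z = 0)"
        "\<And>i. i < m \<Longrightarrow> i \<notin> S \<Longrightarrow> AE z in CT. (\<Sum>l<k. \<Theta> i l z * c l z) = 0"
      by auto
    define a where "a j z = (\<Sum>l<k. \<Theta> j l z * c l z)" for j z
    have aH: "Hinf (a j)" if "j < m" for j
      unfolding a_def[abs_def] using c(1) H that by (intro Hinf_sum Hinf_mult) auto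
    have "a \<in> kerHankel n m \<Phi>"
      unfolding ker by (intro exI[of _ c]) (auto simp: a_def c Hinf_imp_Hp2)
    then have Hp1: "Hp 1 (\<lambda>z. \<Sum>j<m. \<Phi> i j z * a j z)" if "i < n" for i
      using that by (simp add: kerHankel_def)
    have off: "AE z in CT. \<forall>j<m. j \<notin> S \<longrightarrow> a j z = 0"
      by (rule AE_all_less) (use c(4) in \<open>auto simp: a_def\<close>)
    have "Nev (\<lambda>z. \<Sum>j\<in>S. a j z * \<Phi> i j z)" if i: "i < n" for i
    \<comment> \<open>Kernel membership gives only H^1, but \<open>a\<close> is bounded and hence
      \<Phi> a is square integrable; H^1 improves to H^2, for which the quotient representation is
      available.\<close>
    proof (rule Nev_Hp2, rule Hp2_cong_AE)
      have "L2 CT (\<lambda>z. \<Phi> i j z * a j z)" if "j < m" for j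
        using cols i that aH[OF that] by (auto simp: Lp2_iff intro: L2_mult_Hinf)
      then have "L2 CT (\<lambda>z. \<Sum>j<m. \<Phi> i j z * a j z)" by (intro L2_sum) auto
      then show "Hp 2 (\<lambda>z. \<Sum>j<m. \<Phi> i j z * a j z)"
        using Hp1[OF i] by (simp add: Hp1_iff Hp2_iff)
      show "AE z in CT. (\<Sum>j<m. \<Phi> i j z * a j z) = (\<Sum>j\<in>S. a j z * \<Phi> i j z)"
        using off
      proof eventually_elim
        case (elim z)
        show ?case
          by (rule sum.mono_neutral_cong_right) (use elim S(2) in \<open>auto simp: mult.commute\<close>)
      qed
    qed
    moreover have "Nev (a j)" if "j \<in> S" for j
      using that S(2) aH by (intro Nev_Hp2 Hinf_imp_Hp2) auto
    ultimately have on: "AE z in CT. a j z = 0" if "j \<in> S" for j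
      using S(3) that unfolding indep_Nev_def AE_T_iff by blast
    have "AE z in CT. (\<Sum>l<k. \<Theta> i l z * c l z) = 0" if "i < m" for i
      using on[of i] c(4)[OF that] by (cases "i \<in> S") (auto simp: a_def)
    from inner_matrix_injective[OF \<Theta> this c(2)] c(3) show False by blast
  qed
next
  from inner_matrix_row_basis[OF \<Theta>] obtain T where T: "T \<subseteq> {..<m}" "card T = k"
    and inj: "(\<forall>c. (\<forall>l<k. Hinf (c l)) \<and> (\<forall>i\<in>T. AE z in CT. (\<Sum>l<k. \<Theta> i l z * c l z) = 0) \<longrightarrow>
      (\<forall>l<k. AE z in CT. c l z = 0))"
    by (elim exE conjE)
  define S where "S = {..<m} - T"
  have S: "finite S" "S \<subseteq> {..<m}" by (auto simp: S_def)
  have "card S = m - k"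
    using T finite_subset[OF T(1)] by (simp add: S_def card_Diff_subset)
  moreover have "indep_Nev n \<Phi> S"
    unfolding indep_Nev_def AE_T_iff
  proof (intro allI impI ballI, elim conjE)
    fix a j assume a: "\<forall>j\<in>S. Nev (a j)" and \<Phi>a: "\<forall>i<n. Nev (\<lambda>z. \<Sum>j\<in>S. a j z * \<Phi> i j z)" and j: "j \<in> S"
    obtain h1 where h1: "Hinf h1" "AE z in CT. h1 z \<noteq> 0" "\<forall>j\<in>S. Hinf (\<lambda>z. h1 z * a j z)"
      using Nev_common_denominator[OF S(1), of a] a by blast
    obtain h2 where h2: "Hinf h2" "AE z in CT. h2 z \<noteq> 0"
        "\<forall>i\<in>{..<n}. Hinf (\<lambda>z. h2 z * (\<Sum>j\<in>S. a j z * \<Phi> i j z))"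
      using Nev_common_denominator[of "{..<n}" "\<lambda>i z. \<Sum>j\<in>S. a j z * \<Phi> i j z"] \<Phi>a by auto
    \<comment> \<open>The relation is multiplied by both common denominators, one for its
      coefficients and one for its value, and extended by 0 to the rows in \<open>T\<close>; it
      thereby becomes a bounded kernel element.\<close>
    define F where "F j z = (if j \<in> S then h2 z * (h1 z * a j z) else 0)" for j z
    have F: "Hinf (F j)" for j
      unfolding F_def[abs_def] using h1(3) h2(1) by (cases "j \<in> S") (auto simp: Hinf_const intro: Hinf_mult)
    have "Hp 1 (\<lambda>z. \<Sum>j<m. \<Phi> i j z * F j z)" if i: "i < n" for i
    proof -
      have "(\<Sum>j<m. \<Phi> i j z * F j z) = h1 z * (h2 z * (\<Sum>j\<in>S. a j z * \<Phi> i j z))" for z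
      proof -
        have "(\<Sum>j<m. \<Phi> i j z * F j z) = (\<Sum>j\<in>S. h1 z * (h2 z * (a j z * \<Phi> i j z)))"
          by (rule sum.mono_neutral_cong_right) (use S in \<open>auto simp: F_def mult_ac\<close>)
        then show ?thesis by (simp add: sum_distrib_left)
      qed
      moreover have "Hinf (\<lambda>z. h1 z * (h2 z * (\<Sum>j\<in>S. a j z * \<Phi> i j z)))"
        using h2(3) i by (intro Hinf_mult[OF h1(1)]) auto
      ultimately show ?thesis
        using Hinf_imp_Hp2 by (auto simp: Hp1_iff Hp2_iff intro: CT.L2_integrable)
    qed
    then have "F \<in> kerHankel n m \<Phi>" using F by (simp add: kerHankel_def Hinf_imp_Hp2)
    then obtain g where g: "\<And>l. l < k \<Longrightarrow> Hp 2 (g l)"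
        "\<And>j. j < m \<Longrightarrow> AE z in CT. F j z = (\<Sum>l<k. \<Theta> j l z * g l z)"
      unfolding ker by blast
    have gH: "Hinf (g l)" if "l < k" for l
      by (rule inner_coefficients_Hinf[OF \<Theta> F g(1)[OF that] that g(2)])
    have "\<forall>i\<in>T. AE z in CT. (\<Sum>l<k. \<Theta> i l z * g l z) = 0"
    proof
      fix i assume i: "i \<in> T"
      then have "F i z = 0" for z by (simp add: F_def S_def)
      with g(2)[of i] i T(1) show "AE z in CT. (\<Sum>l<k. \<Theta> i l z * g l z) = 0" by auto
    qed
    with inj gH have "\<forall>l<k. AE z in CT. g l z = 0" by blast
    then have "AE z in CT. \<forall>l<k. g l z = 0" by (intro AE_all_less) blast
    moreover have "AE z in CT. F j z = (\<Sum>l<k. \<Theta> j l z * g l z)" using g(2) j S(2) by auto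
    ultimately show "AE z in CT. a j z = 0"
      using h1(2) h2(2) by eventually_elim (use j in \<open>auto simp: F_def\<close>)
  qed
  ultimately show "m - k \<in> {card S | S. S \<subseteq> {..<m} \<and> indep_Nev n \<Phi> S}"
    using S(2) by (auto intro!: exI[of _ S])
qed

theorem mainTheorem1:
  fixes n m :: nat and \<Phi> :: "nat \<Rightarrow> nat \<Rightarrow> complex \<Rightarrow> complex"
  assumes cols: "\<forall>i<n. \<forall>j<m. Lp 2 (\<Phi> i j)"
  defines "r \<equiv> ind_Nev n m \<Phi>"
  shows "(r < m \<longrightarrow>
            (\<exists>\<Theta>. inner_matrix m (m - r) \<Theta> \<and>
               (\<forall>f. f \<in> kerHankel n m \<Phi> \<longleftrightarrow>
                    (\<exists>g. (\<forall>l<m - r. Hp 2 (g l)) \<and>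
                         (\<forall>j<m. AE_T (\<lambda>z. f j z = (\<Sum>l<m - r. \<Theta> j l z * g l z)))))))
       \<and> (r = m \<longrightarrow> (\<forall>f. f \<in> kerHankel n m \<Phi> \<longleftrightarrow> (\<forall>j<m. AE_T (\<lambda>z. f j z = 0))))"
proof -
  have "L2_vecs m (\<Phi> ` {..<n})" "L2_vecs m {}"
    using cols by (auto simp: L2_vecs_def Lp2_iff)
  from beurling_lax_halmos[OF this]
  obtain k \<Theta> where \<Theta>: "inner_matrix m k \<Theta>" and ker: "\<And>f. f \<in> kerHankel n m \<Phi> \<longleftrightarrow>
      (\<exists>g. (\<forall>l<k. Hp 2 (g l)) \<and> (\<forall>j<m. AE z in CT. f j z = (\<Sum>l<k. \<Theta> j l z * g l z)))"
    unfolding kerHankel_eq_invsub[OF cols] by blast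
  have "r = m - k" unfolding r_def by (rule ind_Nev_eq[OF cols \<Theta> ker])
  \<comment> \<open>Subtraction is truncated, so inverting \<open>r = m - k\<close> uses
    \<open>k <= m\<close>. For \<open>r = m\<close> this gives \<open>k = 0\<close>, and the empty
    sum describes the zero kernel.\<close>
  with inner_matrix_le[OF \<Theta>] have k: "k = m - r" by simp
  have "f \<in> kerHankel n m \<Phi> \<longleftrightarrow> (\<forall>j<m. AE_T (\<lambda>z. f j z = 0))" if "r = m" for f
    using ker[of f] k that by (simp add: AE_T_iff)
  moreover have "\<exists>\<Theta>. inner_matrix m (m - r) \<Theta> \<and> (\<forall>f. f \<in> kerHankel n m \<Phi> \<longleftrightarrow>
      (\<exists>g. (\<forall>l<m - r. Hp 2 (g l)) \<and> (\<forall>j<m. AE_T (\<lambda>z. f j z = (\<Sum>l<m - r. \<Theta> j l z * g l z)))))"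
    using \<Theta> ker unfolding k AE_T_iff by blast
  ultimately show ?thesis by blast
qed

end
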